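(* Let $n\ge 3$ and let $\mathbf J=(J_1,\dots,J_n)$ be fixed with all $J_i>0$. For $\beta>0$ let $\tau_2(\beta\mathbf J)$ be the relaxation time of the heat-bath Glauber dynamics for the ferromagnetic Ising model on the $n$-cycle with couplings $\beta J_1,\dots,\beta J_n$. Let $J_{\max}=\max_i J_i$ and $J_{\min}=\min_i J_i$. Then $$\lim_{\beta\to\infty}\frac{\tau_2(\beta\mathbf J)}{\exp(C\beta)}=D,$$ where $C=2(J_{\max}+J_{\min})$ and $D=\dfrac12\cdot\dfrac{\#\{i:J_i=J_{\max}\}}{\#\{i:J_i=J_{\min}\}}$.
   Context: The cycle has vertices $\{1,\dots,n\}$ and edges $[1,2],[2,3],\dots,[n,1]$; indices are taken mod $n$, so $n+1\equiv 1$. For couplings $J_1,\dots,J_n>0$, the edge $[i,i+1]$ has coupling $J_i$. A configuration is $\sigma\in\{+1,-1\}^n$, and the Gibbs measure (no external field, no boundary conditions) is $\pi(\sigma)=Z^{-1}\exp\big(\sum_{i=1}^n J_i\sigma_i\sigma_{i+1}\big)$, where $Z$ is the normalizing constant. For a vertex $i$, let $\sigma^i$ be the configuration obtained from $\sigma$ by flipping the spin at $i$. The heat-bath Glauber dynamics is the Markov chain on $\{+1,-1\}^n$ with transition matrix $A$ of size $2^n\times 2^n$ given by $A(\sigma,\sigma^i)=\frac1n\,\frac{\pi(\sigma^i)}{\pi(\sigma)+\pi(\sigma^i)}$ for each $i$, $A(\sigma,\sigma)=1-\sum_{i}A(\sigma,\sigma^i)$, and $A(\sigma,\tau)=0$ for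 all other $\tau$. It is reversible with respect to $\pi$, so its eigenvalues are real; they are listed with multiplicity as $1=\mu_1>\mu_2\ge\dots\ge\mu_{2^n}$. The relaxation time is $\tau_2=\big(n(1-\mu_2)\big)^{-1}$; $\tau_2(\beta\mathbf J)$ denotes this quantity when each $J_i$ is replaced by $\beta J_i$. *)

theory Defs
  imports
    "Jordan_Normal_Form.Char_Poly"
    "HOL-Library.FuncSet"
begin

text \<open>
  The vertices of the \<open>n\<close>-cycle are \<open>0, \<dots>, n - 1\<close>; the edge \<open>[i, i + 1 mod n]\<close> has coupling \<open>J i\<close>.
  Only the values of \<open>J\<close> below \<open>n\<close> matter.
\<close>

definition spin_configs :: "nat \<Rightarrow> (nat \<Rightarrow> real) set" where
  "spin_configs n = {..<n} \<rightarrow>\<^sub>E {1, -1}"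

definition gibbs_weight :: "nat \<Rightarrow> (nat \<Rightarrow> real) \<Rightarrow> (nat \<Rightarrow> real) \<Rightarrow> real" where
  "gibbs_weight n J \<sigma> = exp (\<Sum>i<n. J i * \<sigma> i * \<sigma> ((i + 1) mod n))"

definition partition_function :: "nat \<Rightarrow> (nat \<Rightarrow> real) \<Rightarrow> real" where
  "partition_function n J = (\<Sum>\<sigma>\<in>spin_configs n. gibbs_weight n J \<sigma>)"

definition gibbs :: "nat \<Rightarrow> (nat \<Rightarrow> real) \<Rightarrow> (nat \<Rightarrow> real) \<Rightarrow> real" where
  "gibbs n J \<sigma> = gibbs_weight n J \<sigma> / partition_function n J"

definition flip_spin :: "nat \<Rightarrow> (nat \<Rightarrow> real) \<Rightarrow> (nat \<Rightarrow> real)" where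
  "flip_spin i \<sigma> = \<sigma>(i := - \<sigma> i)"

definition flip_prob :: "nat \<Rightarrow> (nat \<Rightarrow> real) \<Rightarrow> (nat \<Rightarrow> real) \<Rightarrow> nat \<Rightarrow> real" where
  "flip_prob n J \<sigma> i =
     1 / real n * (gibbs n J (flip_spin i \<sigma>) / (gibbs n J \<sigma> + gibbs n J (flip_spin i \<sigma>)))"

text \<open>For \<open>\<sigma>\<close> and \<open>\<tau>\<close> in \<^term>\<open>spin_configs n\<close> there is at most one \<open>i\<close> with \<open>\<tau> = flip_spin i \<sigma>\<close>.\<close>

definition glauber :: "nat \<Rightarrow> (nat \<Rightarrow> real) \<Rightarrow> (nat \<Rightarrow> real) \<Rightarrow> (nat \<Rightarrow> real) \<Rightarrow> real" where
  "glauber n J \<sigma> \<tau> =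
     (if \<tau> = \<sigma> then 1 - (\<Sum>i<n. flip_prob n J \<sigma> i)
      else if \<exists>i<n. \<tau> = flip_spin i \<sigma>
           then flip_prob n J \<sigma> (THE i. i < n \<and> \<tau> = flip_spin i \<sigma>)
      else 0)"

text \<open>
  To view \<^const>\<open>glauber\<close> as a square matrix, the configurations are numbered by
  \<open>0, \<dots>, 2 ^ n - 1\<close> through binary digits. The numbering does not affect the spectrum.
\<close>

definition config_of_index :: "nat \<Rightarrow> nat \<Rightarrow> nat \<Rightarrow> real" where
  "config_of_index n k = (\<lambda>i\<in>{..<n}. if bit k i then 1 else -1)"

lemma bij_betw_config_of_index:
  "bij_betw (config_of_index n) {..<2 ^ n} (spin_configs n)"
proof -
  have inj: "inj_on (config_of_index n) {..<2 ^ n}"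
  proof (rule inj_onI)
    fix k l :: nat
    assume k: "k \<in> {..<2 ^ n}" and l: "l \<in> {..<2 ^ n}"
      and eq: "config_of_index n k = config_of_index n l"
    have bits: "bit k i = bit l i" if "i < n" for i
      using fun_cong[OF eq, of i] that
      by (simp add: config_of_index_def split: if_splits)
    have "take_bit n k = take_bit n l"
      by (rule bit_eqI) (auto simp: bit_take_bit_iff bits)
    then show "k = l"
      using k l by (simp add: take_bit_nat_eq_self)
  qed
  moreover have "config_of_index n ` {..<2 ^ n} \<subseteq> spin_configs n"
    by (auto simp: config_of_index_def spin_configs_def PiE_iff split: if_splits)
  moreover have "card (spin_configs n) = 2 ^ n" "finite (spin_configs n)"
    by (auto simp: spin_configs_def card_PiE numeral_2_eq_2 intro!: finite_PiE)
  ultimately show ?thesis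
    by (simp add: bij_betw_def card_image card_subset_eq)
qed

definition glauber_mat :: "nat \<Rightarrow> (nat \<Rightarrow> real) \<Rightarrow> real mat" where
  "glauber_mat n J =
     mat (2 ^ n) (2 ^ n) (\<lambda>(k, l). glauber n J (config_of_index n k) (config_of_index n l))"

text \<open>
  Real eigenvalues with algebraic multiplicity, in non-increasing order, indexed from 0.
  The matrix \<^term>\<open>glauber_mat n J\<close> is reversible, hence diagonalisable over the reals, so that its
  list has length \<open>2 ^ n\<close> and algebraic and geometric multiplicities agree.
\<close>

definition eigenvalues_desc :: "real mat \<Rightarrow> real list" where
  "eigenvalues_desc A = rev (sorted_list_of_multiset (proots (char_poly A)))"

definition relaxation_time :: "nat \<Rightarrow> (nat \<Rightarrow> real) \<Rightarrow> real" where
  "relaxation_time n J = inverse (real n * (1 - eigenvalues_desc (glauber_mat n J) ! 1))"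

end

theory Submission
  imports Defs "HOL-Analysis.Function_Topology"
begin

text \<open>
  Given its neighbours, the mean of a spin on the cycle is a linear function of them, so the dynamics
  preserves the linear functions of the spins. Conjugating by a diagonal matrix makes its restriction to
  them symmetric, which gives a positive (Perron) eigenvector and a Rayleigh quotient for
  its eigenvalue \<open>1 - \<gamma> / n\<close>. With the Perron vector as weights, path coupling
  contracts Lipschitz constants by exactly this factor, so no other eigenfunction apart from the constants
  can have a larger eigenvalue, and the relaxation time is \<open>1 / \<gamma>\<close>. At low temperature the constant vector
  asymptotically minimises the Rayleigh quotient, because the energy cost of any variation
  grows like \<open>exp (2 \<beta> J\<^sub>m\<^sub>i\<^sub>n)\<close>.
\<close>

section \<open>The second eigenvalue of a matrix with unit row sums\<close>

text \<open>The mean is linear because each vertex has two neighbours: in \<open>tanh (a + b) =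
  (sinh (2 * a) + sinh (2 * b)) / (cosh (2 * a) + cosh (2 * b))\<close> a change of sign of
  \<open>a\<close> or \<open>b\<close> affects only the numerator. The relaxation time reads its
  eigenvalue off a sorted list of roots with algebraic multiplicity. So 1 must be shown to be a
  simple root of the characteristic polynomial, not merely to have one-dimensional eigenspace. This
  is why the matrix is reduced modulo constants and why eigenfunctions are studied up to an additive
  constant. The constants \<open>C\<close> and \<open>D\<close> are those of the constant vector. On
  it the numerator of the Rayleigh quotient is the sum of
  \<open>2 * exp (- 2 * \<beta> * J i)\<close>, dominated by the weakest edges, and the denominator
  is the sum of \<open>2 * cosh (2 * \<beta> * J i)\<close>, dominated by the strongest ones. The
  \<open>1 / 2\<close> in \<open>D\<close> remains because \<open>2 * cosh\<close> grows like a
  single exponential.\<close>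

text \<open>\<open>B\<close> is the action of \<open>A\<close> on the quotient by the constant vectors.\<close>

lemma row_sums_one_char_poly:
  fixes A :: "'a :: field mat"
  assumes A: "A \<in> carrier_mat (Suc m) (Suc m)"
    and ones: "A *\<^sub>v vec (Suc m) (\<lambda>_. 1) = vec (Suc m) (\<lambda>_. 1)"
  obtains B where "B \<in> carrier_mat m m" "char_poly A = [:- 1, 1:] * char_poly B"
    "\<And>y \<mu>. y \<in> carrier_vec m \<Longrightarrow> B *\<^sub>v y = \<mu> \<cdot>\<^sub>v y \<Longrightarrow>
      \<exists>c. A *\<^sub>v (vCons 0 y) = \<mu> \<cdot>\<^sub>v vCons 0 y + vec (Suc m) (\<lambda>_. c)"
proof -
  let ?N = "Suc m"
  \<comment> \<open>\<open>P\<close> replaces the first basis vector by the all-ones vector and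
    keeps the others; \<open>Q\<close> is its inverse. In the new basis the first column of
    \<open>A\<close> is the first unit vector, which produces the block triangular form.\<close>
  define P :: "'a mat" where "P = mat ?N ?N (\<lambda>(i, j). if i = j \<or> j = 0 then 1 else 0)"
  define Q :: "'a mat" where "Q = mat ?N ?N (\<lambda>(i, j). if i = j then 1 else if j = 0 then - 1 else 0)"
  have P: "P \<in> carrier_mat ?N ?N" and Q: "Q \<in> carrier_mat ?N ?N"
    by (auto simp: P_def Q_def)
  have mult_P: "P *\<^sub>v x = vec ?N (\<lambda>i. if i = 0 then x $ 0 else x $ 0 + x $ i)"
    if "x \<in> carrier_vec ?N" for x
  proof (rule eq_vecI)
    fix i assume i: "i < dim_vec (vec ?N (\<lambda>i. if i = 0 then x $ 0 else x $ 0 + x $ i))"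
    have "(P *\<^sub>v x) $ i = (\<Sum>k = 0..<?N. (if i = k \<or> k = 0 then 1 else 0) * x $ k)"
      using i that by (auto simp: P_def scalar_prod_def simp del: sum.op_ivl_Suc intro!: sum.cong)
    also have "\<dots> = (\<Sum>k = 0..<?N. (if k = i then x $ k else 0) + (if k = 0 then if i = 0 then 0 else x $ k else 0))"
      by (intro sum.cong) auto
    also have "\<dots> = (if i = 0 then x $ 0 else x $ 0 + x $ i)"
      using i by (subst sum.distrib, subst sum.delta, simp, subst sum.delta) auto
    finally show "(P *\<^sub>v x) $ i = vec ?N (\<lambda>i. if i = 0 then x $ 0 else x $ 0 + x $ i) $ i"
      using i by simp
  qed (simp add: P_def)
  have mult_Q: "Q *\<^sub>v x = vec ?N (\<lambda>i. if i = 0 then x $ 0 else x $ i - x $ 0)"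
    if "x \<in> carrier_vec ?N" for x
  proof (rule eq_vecI)
    fix i assume i: "i < dim_vec (vec ?N (\<lambda>i. if i = 0 then x $ 0 else x $ i - x $ 0))"
    have "(Q *\<^sub>v x) $ i = (\<Sum>k = 0..<?N. (if i = k then 1 else if k = 0 then - 1 else 0) * x $ k)"
      using i that by (auto simp: Q_def scalar_prod_def simp del: sum.op_ivl_Suc intro!: sum.cong)
    also have "\<dots> = (\<Sum>k = 0..<?N. (if k = i then x $ k else 0) + (if k = 0 then if i = 0 then 0 else - x $ k else 0))"
      by (intro sum.cong) auto
    also have "\<dots> = (if i = 0 then x $ 0 else x $ i - x $ 0)"
      using i by (subst sum.distrib, subst sum.delta, simp, subst sum.delta) auto
    finally show "(Q *\<^sub>v x) $ i = vec ?N (\<lambda>i. if i = 0 then x $ 0 else x $ i - x $ 0) $ i"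
      using i by simp
  qed (simp add: Q_def)
  have PQ: "P * Q = 1\<^sub>m ?N"
  proof (rule eq_matI)
    fix i j assume ij: "i < dim_row (1\<^sub>m ?N :: 'a mat)" "j < dim_col (1\<^sub>m ?N :: 'a mat)"
    have "(P * Q) $$ (i, j) = (P *\<^sub>v col Q j) $ i"
      using ij P Q by simp
    also have "\<dots> = 1\<^sub>m ?N $$ (i, j)"
      using ij Q by (subst mult_P) (auto simp: Q_def)
    finally show "(P * Q) $$ (i, j) = 1\<^sub>m ?N $$ (i, j)" .
  qed (auto simp: P_def Q_def)
  have QP: "Q * P = 1\<^sub>m ?N"
    using mat_mult_left_right_inverse[OF P Q PQ] .
  define B' where "B' = Q * A * P"
  have B': "B' \<in> carrier_mat ?N ?N"
    using A P Q by (simp add: B'_def)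
  have B'_vec: "B' *\<^sub>v x = Q *\<^sub>v (A *\<^sub>v (P *\<^sub>v x))" if "x \<in> carrier_vec ?N" for x
    using that A P Q by (simp add: B'_def assoc_mult_mat_vec[of _ ?N ?N _ ?N])
  have AP: "A *\<^sub>v (P *\<^sub>v x) = P *\<^sub>v (B' *\<^sub>v x)" if x: "x \<in> carrier_vec ?N" for x
  proof -
    have z: "A *\<^sub>v (P *\<^sub>v x) \<in> carrier_vec ?N"
      using A P x by simp
    then show ?thesis
      using assoc_mult_mat_vec[OF P Q z] by (simp add: B'_vec[OF x] PQ)
  qed
  have P_unit: "P *\<^sub>v unit_vec ?N 0 = vec ?N (\<lambda>_. 1)"
    by (subst mult_P) auto
  have "B' *\<^sub>v unit_vec ?N 0 = unit_vec ?N 0"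
    by (simp add: B'_vec P_unit ones mult_Q) auto
  then have col0: "B' $$ (i, 0) = (if i = 0 then 1 else 0)" if "i < ?N" for i
  proof -
    have "(B' *\<^sub>v unit_vec ?N 0) $ i = B' $$ (i, 0)"
      using that B' by (simp add: scalar_prod_right_unit[of _ ?N])
    then show ?thesis
      using \<open>B' *\<^sub>v unit_vec ?N 0 = unit_vec ?N 0\<close> that by simp
  qed
  define B where "B = mat m m (\<lambda>(i, j). B' $$ (Suc i, Suc j))"
  define r where "r = mat 1 m (\<lambda>(i, j). B' $$ (0, Suc j))"
  have B'_block: "B' = four_block_mat (1\<^sub>m 1) r (0\<^sub>m m 1) B"
    using B' col0 by (intro eq_matI) (auto simp: B_def r_def)
  have B: "B \<in> carrier_mat m m" and r: "r \<in> carrier_mat 1 m"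
    by (auto simp: B_def r_def)
  have "P * B' * Q = (P * Q) * A * (P * Q)"
    using A P Q by (simp add: B'_def assoc_mult_mat[of _ ?N ?N _ ?N _ ?N])
  then have "A = P * B' * Q"
    using A by (simp add: PQ)
  then have "similar_mat A B'"
    using A B' P Q PQ QP by (intro similar_matI[of A B' P Q ?N]) auto
  then have "char_poly A = char_poly (1\<^sub>m 1) * char_poly B"
    using B r char_poly_four_block_zeros_col[of "1\<^sub>m 1" r m B]
    by (simp add: char_poly_similar B'_block)
  also have "char_poly (1\<^sub>m 1 :: 'a mat) = [:- 1, 1:]"
    by (subst char_poly_upper_triangular[of _ 1]) (auto simp: diag_mat_def)
  finally have "char_poly A = [:- 1, 1:] * char_poly B" .
  moreover have "\<exists>c. A *\<^sub>v (vCons 0 y) = \<mu> \<cdot>\<^sub>v vCons 0 y + vec (Suc m) (\<lambda>_. c)"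
    if y: "y \<in> carrier_vec m" and ev: "B *\<^sub>v y = \<mu> \<cdot>\<^sub>v y" for y \<mu>
  proof
    \<comment> \<open>The class of \<open>y\<close> modulo constants is represented by the vector
      with first entry 0, which \<open>P\<close> fixes. The first row \<open>r\<close> of the block
      form supplies the additive constant.\<close>
    define x where "x = vCons 0 y"
    have x: "x \<in> carrier_vec ?N"
      using y by (simp add: x_def)
    have x_eq: "P *\<^sub>v x = x"
      using x by (subst mult_P) (auto simp: x_def)
    have "B' *\<^sub>v x = vCons (scalar_prod (row r 0) y) (B *\<^sub>v y)"
    proof (rule eq_vecI)
      fix i assume "i < dim_vec (vCons (scalar_prod (row r 0) y) (B *\<^sub>v y))"
      then have "i < ?N"
        using B by simp
      then have "(B' *\<^sub>v x) $ i = (\<Sum>k = 0..<?N. B' $$ (i, k) * x $ k)"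
        using B' x by (auto simp: scalar_prod_def simp del: sum.op_ivl_Suc intro!: sum.cong)
      also have "\<dots> = (\<Sum>k = 0..<m. B' $$ (i, Suc k) * y $ k)"
        by (simp add: x_def sum.atLeast0_lessThan_Suc_shift del: sum.op_ivl_Suc)
      also have "\<dots> = vCons (scalar_prod (row r 0) y) (B *\<^sub>v y) $ i"
        using \<open>i < ?N\<close> y by (cases i) (auto simp: scalar_prod_def B_def r_def intro!: sum.cong)
      finally show "(B' *\<^sub>v x) $ i = vCons (scalar_prod (row r 0) y) (B *\<^sub>v y) $ i" .
    qed (use B B' in simp)
    then have "A *\<^sub>v x = P *\<^sub>v vCons (scalar_prod (row r 0) y) (\<mu> \<cdot>\<^sub>v y)"
      using AP[OF x] by (simp add: x_eq ev)
    also have "\<dots> = \<mu> \<cdot>\<^sub>v x + vec ?N (\<lambda>_. scalar_prod (row r 0) y)"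
      using y by (subst mult_P) (auto simp: x_def less_Suc_eq_0_disj intro!: eq_vecI)
    finally show "A *\<^sub>v (vCons 0 y) = \<mu> \<cdot>\<^sub>v vCons 0 y + vec (Suc m) (\<lambda>_. scalar_prod (row r 0) y)"
      by (simp add: x_def)
  qed
  ultimately show ?thesis
    using B that by blast
qed

text \<open>A second root 1 would be an eigenvalue of the quotient matrix \<open>B\<close>, and its
  eigenvector would lift to a vector that \<open>A\<close> fixes up to a constant. With
  \<open>c = 0\<close> the hypothesis \<open>const\<close> excludes further fixed vectors; with
  \<open>c \<noteq> 0\<close> it excludes a Jordan block at 1.\<close>

lemma order_one_char_poly:
  fixes A :: "'a :: field mat"
  assumes A: "A \<in> carrier_mat (Suc m) (Suc m)"
    and ones: "A *\<^sub>v vec (Suc m) (\<lambda>_. 1) = vec (Suc m) (\<lambda>_. 1)"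
    and const: "\<And>x c. x \<in> carrier_vec (Suc m) \<Longrightarrow> A *\<^sub>v x = x + vec (Suc m) (\<lambda>_. c)
      \<Longrightarrow> \<exists>a. x = vec (Suc m) (\<lambda>_. a)"
  shows "order 1 (char_poly A) = 1"
proof -
  obtain B where B: "B \<in> carrier_mat m m" and cp: "char_poly A = [:- 1, 1:] * char_poly B"
    and lift: "\<And>y \<mu>. y \<in> carrier_vec m \<Longrightarrow> B *\<^sub>v y = \<mu> \<cdot>\<^sub>v y \<Longrightarrow>
      \<exists>c. A *\<^sub>v (vCons 0 y) = \<mu> \<cdot>\<^sub>v vCons 0 y + vec (Suc m) (\<lambda>_. c)"
    by (rule row_sums_one_char_poly[OF A ones]) blast
  have "\<not> eigenvalue B 1"
  proof
    assume "eigenvalue B 1"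
    then obtain y where y: "y \<in> carrier_vec m" "y \<noteq> 0\<^sub>v m" "B *\<^sub>v y = 1 \<cdot>\<^sub>v y"
      using B by (auto simp: eigenvalue_def eigenvector_def)
    obtain c where "A *\<^sub>v (vCons 0 y) = vCons 0 y + vec (Suc m) (\<lambda>_. c)"
      using lift[OF y(1,3)] by auto
    then obtain a where a: "vCons 0 y = vec (Suc m) (\<lambda>_. a)"
      using const y(1) by (metis vCons_carrier_vec)
    then have "a = 0"
      by (metis index_vec vec_index_vCons_0 zero_less_Suc)
    with a have "y = 0\<^sub>v m"
      by (auto simp: vec_Suc)
    with y show False by simp
  qed
  then have "order 1 (char_poly B) = 0"
    using eigenvalue_root_char_poly[OF B] by (auto intro: order_0I)
  moreover have "order 1 [:- 1, 1 :: 'a:] = 1"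
    using order_power_n_n[of 1 1] by simp
  moreover have "char_poly A \<noteq> 0"
    using degree_monic_char_poly[OF A] by auto
  moreover from this have "order 1 (char_poly A) = order 1 [:- 1, 1 :: 'a:] + order 1 (char_poly B)"
    unfolding cp by (rule order_mult)
  ultimately show ?thesis by simp
qed

text \<open>The ascending list of roots ends in \<open>[b, a]\<close>. A second copy of
  \<open>a\<close> would occupy position 1, hence the assumption on its order; \<open>b\<close> may
  be repeated.\<close>

lemma eigenvalues_desc_nth_1:
  assumes p: "char_poly A \<noteq> 0" and 1: "order a (char_poly A) = 1"
    and "poly (char_poly A) b = 0" "b < a"
    and le: "\<And>x. poly (char_poly A) x = 0 \<Longrightarrow> x \<noteq> a \<Longrightarrow> x \<le> b"
  shows "eigenvalues_desc A ! 1 = b"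
proof -
  define M where "M = proots (char_poly A)"
  define R where "R = M - {#a, b#}"
  have cM: "count M x = order x (char_poly A)" for x
    using p by (simp add: M_def)
  have sM: "set_mset M = {x. poly (char_poly A) x = 0}"
    using p by (simp add: M_def)
  have "b \<in># M" "a \<in># M" using assms sM cM[of a] by (auto simp: count_inI)
  then have M: "M = R + {#b, a#}"
    using \<open>b < a\<close> by (intro multiset_eqI) (auto simp: R_def count_greater_zero_iff[symmetric] simp del: count_greater_zero_iff)
  have R: "x \<le> b" if "x \<in># R" for x
  proof -
    have "count R a = 0"
      using cM[of a] 1 \<open>b < a\<close> by (simp add: M)
    with that have "x \<noteq> a"
      by (auto simp: count_eq_zero_iff)
    moreover have "x \<in># M" using that by (simp add: M)
    ultimately show ?thesis using le sM by auto
  qed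
  have "sorted_list_of_multiset M = sorted_list_of_multiset R @ [b, a]"
  proof -
    have "sort (sorted_list_of_multiset R @ [b, a]) = sorted_list_of_multiset R @ [b, a]"
      using R \<open>b < a\<close> by (intro sorted_sort_id) (fastforce simp: sorted_append)
    then show ?thesis
      by (metis M mset_append mset_sorted_list_of_multiset sorted_list_of_multiset_mset mset.simps)
  qed
  then show ?thesis
    by (simp add: eigenvalues_desc_def M_def)
qed

section \<open>The Rayleigh quotient of the linear functions\<close>

locale ising_cycle =
  fixes n :: nat and J :: "nat \<Rightarrow> real"
  assumes n3: "n \<ge> 3" and J_pos: "\<And>i. i < n \<Longrightarrow> J i > 0"
begin

section \<open>Neighbours on the cycle\<close>

definition nxt :: "nat \<Rightarrow> nat" where "nxt i = (i + 1) mod n"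

definition prv :: "nat \<Rightarrow> nat" where "prv i = (i + n - 1) mod n"

lemma nxt_less [simp]: "nxt i < n" and prv_less [simp]: "prv i < n"
  using n3 by (auto simp: nxt_def prv_def)

lemma nxt_if: "i < n \<Longrightarrow> nxt i = (if i = n - 1 then 0 else i + 1)"
  using n3 by (auto simp: nxt_def)

lemma prv_if: "i < n \<Longrightarrow> prv i = (if i = 0 then n - 1 else i - 1)"
proof (cases i)
  case (Suc k)
  moreover assume "i < n"
  ultimately show ?thesis by (auto simp: prv_def)
qed (use n3 in \<open>auto simp: prv_def\<close>)

lemma nxt_prv [simp]: "i < n \<Longrightarrow> nxt (prv i) = i"
  and prv_nxt [simp]: "i < n \<Longrightarrow> prv (nxt i) = i"
  using n3 by (auto simp: nxt_if prv_if)

text \<open>On a cycle of length 2 the two neighbours of a vertex would coincide.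
  \<open>n \<ge> 3\<close> keeps its two edges apart in the later case splits.\<close>

lemma nxt_neq [simp]: "i < n \<Longrightarrow> nxt i \<noteq> i" "i < n \<Longrightarrow> i \<noteq> nxt i"
  and prv_neq [simp]: "i < n \<Longrightarrow> prv i \<noteq> i" "i < n \<Longrightarrow> i \<noteq> prv i"
  and nxt_neq_prv [simp]: "i < n \<Longrightarrow> nxt i \<noteq> prv i" "i < n \<Longrightarrow> prv i \<noteq> nxt i"
  using n3 by (auto simp: nxt_if prv_if)

lemma sum_nxt: "(\<Sum>i<n. f (nxt i)) = (\<Sum>i<n. f i)"
  by (rule sum.reindex_bij_witness[of _ prv nxt]) auto

lemma sum_prv: "(\<Sum>i<n. f (prv i)) = (\<Sum>i<n. f i)"
  by (rule sum.reindex_bij_witness[of _ nxt prv]) auto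

section \<open>Edge weights and the two quadratic forms\<close>

definition c :: "nat \<Rightarrow> real" where "c i = cosh (2 * J i)"

definition s :: "nat \<Rightarrow> real" where "s i = sinh (2 * J i)"

text \<open>The common denominator of the mean of spin \<open>i\<close> for all four settings of its
  neighbours; it comes from the addition formula for \<open>tanh\<close> with doubled
  arguments.\<close>

definition d :: "nat \<Rightarrow> real" where "d i = c (prv i) + c i"

lemma c_ge_1: "c i \<ge> 1" and c_pos: "c i > 0"
  by (auto simp: c_def cosh_real_ge_1 cosh_real_pos)

lemma s_pos: "i < n \<Longrightarrow> s i > 0"
  using J_pos by (simp add: s_def)

lemma c_minus_s: "c i - s i = exp (- 2 * J i)"
  by (simp add: c_def s_def cosh_minus_sinh)

lemma d_pos: "d i > 0"
  by (simp add: d_def c_pos add_pos_pos)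

text \<open>
  \<open>Num v / Den v\<close> is the Rayleigh quotient of \<open>1 - D\<^sup>-\<^sup>1 S\<close> with respect to \<open>D = diag d\<close>, where
  \<open>S\<close> is symmetric with entries \<open>s i\<close> at \<open>(i, nxt i)\<close> and \<open>(nxt i, i)\<close>.
\<close>

definition Den :: "(nat \<Rightarrow> real) \<Rightarrow> real" where
  "Den v = (\<Sum>i<n. c i * ((v i)\<^sup>2 + (v (nxt i))\<^sup>2))"

definition Num :: "(nat \<Rightarrow> real) \<Rightarrow> real" where
  "Num v = (\<Sum>i<n. s i * (v i - v (nxt i))\<^sup>2 + exp (- 2 * J i) * ((v i)\<^sup>2 + (v (nxt i))\<^sup>2))"

text \<open>The definition of \<open>Num\<close> is a sum of nonnegative terms, suited to lower
  bounds. This form isolates the cross terms, suited to taking absolute values and to the first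
  variation. The two agree because \<open>c i - s i = exp (- 2 * J i)\<close>.\<close>

lemma Num_eq: "Num v = Den v - 2 * (\<Sum>i<n. s i * v i * v (nxt i))"
proof -
  have "s i * (v i - v (nxt i))\<^sup>2 + exp (- 2 * J i) * ((v i)\<^sup>2 + (v (nxt i))\<^sup>2) =
      c i * ((v i)\<^sup>2 + (v (nxt i))\<^sup>2) - 2 * (s i * v i * v (nxt i))" for i
    unfolding c_minus_s[symmetric] by (simp add: power2_eq_square algebra_simps)
  then show ?thesis
    by (simp add: Num_def Den_def sum_subtractf sum_distrib_left)
qed

lemma Den_ge: "j < n \<Longrightarrow> (v j)\<^sup>2 \<le> Den v"
proof -
  assume "j < n"
  have "(v j)\<^sup>2 \<le> 1 * ((v j)\<^sup>2 + (v (nxt j))\<^sup>2)"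
    by simp
  also have "\<dots> \<le> c j * ((v j)\<^sup>2 + (v (nxt j))\<^sup>2)"
    by (intro mult_right_mono c_ge_1) simp
  also have "\<dots> \<le> Den v"
    unfolding Den_def using \<open>j < n\<close> c_pos
    by (intro member_le_sum) (auto simp: less_imp_le)
  finally show ?thesis .
qed

lemma Num_pos:
  assumes "j < n" "v j \<noteq> 0"
  shows "Num v > 0"
proof -
  have "0 < exp (- 2 * J j) * ((v j)\<^sup>2 + (v (nxt j))\<^sup>2)"
    using assms by (simp add: add_pos_nonneg)
  also have "\<dots> \<le> s j * (v j - v (nxt j))\<^sup>2 + exp (- 2 * J j) * ((v j)\<^sup>2 + (v (nxt j))\<^sup>2)"
    using s_pos[OF assms(1)] by simp
  also have "\<dots> \<le> Num v"
    unfolding Num_def using assms(1) s_pos by (intro member_le_sum) (auto simp: less_imp_le)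
  finally show ?thesis .
qed

text \<open>Vectors are functions on all natural numbers, so \<open>Den v = 1\<close> alone leaves
  infinitely many coordinates free. Setting these to 0 changes neither form, and
  \<open>Den_ge\<close> puts the remaining ones in \<open>{-1..1}\<close>, which gives a compact set
  in the product topology.\<close>

lemma rayleigh_min_exists:
  "\<exists>v. Den v = 1 \<and> (\<forall>u. Den u = 1 \<longrightarrow> Num v \<le> Num u)"
proof -
  define K :: "(nat \<Rightarrow> real) set" where "K = PiE UNIV (\<lambda>i. if i < n then {-1..1} else {0})"
  have "compactin (product_topology (\<lambda>_. euclideanreal) UNIV) K"
    unfolding K_def by (subst compactin_PiE) auto
  then have "compact K"
    by (simp add: euclidean_product_topology)
  have cont: "continuous_on UNIV (\<lambda>v :: nat \<Rightarrow> real. v i)" for i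
    by simp
  have Den_cont: "continuous_on UNIV Den"
    unfolding Den_def by (intro continuous_intros cont)
  have Num_cont: "continuous_on UNIV Num"
    unfolding Num_def by (intro continuous_intros cont)
  have "closed {v. Den v = 1}"
    by (intro closed_Collect_eq Den_cont continuous_intros)
  with \<open>compact K\<close> have K1: "compact (K \<inter> {v. Den v = 1})"
    by blast
  have normalise: "\<exists>u'\<in>K. Den u' = 1 \<and> Num u' = Num u" if "Den u = 1" for u
  proof
    define u' where "u' = (\<lambda>i. if i < n then u i else 0)"
    show "Den u' = 1 \<and> Num u' = Num u"
      using that by (auto simp: u'_def Den_def Num_def)
    have "\<bar>u i\<bar> \<le> 1" if "i < n" for i
      using Den_ge[OF that, of u] \<open>Den u = 1\<close> by (simp add: abs_square_le_1)
    then show "u' \<in> K"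
      by (force simp: K_def u'_def abs_le_iff)
  qed
  define D1 where "D1 = Den (\<lambda>_. 1)"
  have "D1 \<ge> 1"
    using Den_ge[of 0 "\<lambda>_. 1"] n3 by (simp add: D1_def)
  then have "Den (\<lambda>_. 1 / sqrt D1) = 1"
    by (simp add: D1_def Den_def power_divide flip: sum_divide_distrib)
  then have "K \<inter> {v. Den v = 1} \<noteq> {}"
    using normalise by blast
  then obtain v where "v \<in> K \<inter> {v. Den v = 1}" and min: "\<And>u. u \<in> K \<Longrightarrow> Den u = 1 \<Longrightarrow> Num v \<le> Num u"
    using continuous_attains_inf[OF K1 _ continuous_on_subset[OF Num_cont subset_UNIV]] by blast
  have "Num v \<le> Num u" if "Den u = 1" for u
    using normalise[OF that] min by metis
  moreover have "Den v = 1"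
    using \<open>v \<in> K \<inter> {v. Den v = 1}\<close> by simp
  ultimately show ?thesis by blast
qed

lemma Den_scale: "Den (\<lambda>i. a * v i) = a\<^sup>2 * Den v"
  by (simp add: Den_def sum_distrib_left power_mult_distrib algebra_simps)

lemma Num_scale: "Num (\<lambda>i. a * v i) = a\<^sup>2 * Num v"
  by (simp add: Num_eq Den_scale sum_distrib_left power2_eq_square algebra_simps)

text \<open>The last conclusion is \<open>S v = (1 - \<gamma>) D v\<close> in coordinates. As the
  entries of \<open>S\<close> are nonnegative, replacing a minimiser by its absolute values keeps
  \<open>Den\<close> and does not raise \<open>Num\<close>, so a nonnegative minimiser exists.
  Stationarity gives the equation, and the equation upgrades nonnegativity to positivity.\<close>

lemma perron_vector_exists:
  obtains \<gamma> v where "0 < \<gamma>" "\<And>i. i < n \<Longrightarrow> 0 < v i" "Num v = \<gamma> * Den v"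
    "\<And>u. \<gamma> * Den u \<le> Num u"
    "\<And>j. j < n \<Longrightarrow> s j * v (nxt j) + s (prv j) * v (prv j) = (1 - \<gamma>) * (d j * v j)"
proof -
  obtain v0 where v0: "Den v0 = 1" and min: "\<And>u. Den u = 1 \<Longrightarrow> Num v0 \<le> Num u"
    using rayleigh_min_exists by blast
  define \<gamma> where "\<gamma> = Num v0"
  define v where "v i = \<bar>v0 i\<bar>" for i
  have v_nonneg: "v i \<ge> 0" for i
    by (simp add: v_def)
  have Den_v: "Den v = 1"
    using v0 by (simp add: Den_def v_def)
  have le: "s i * v0 i * v0 (nxt i) \<le> s i * v i * v (nxt i)" if "i < n" for i
    using s_pos[OF that] abs_ge_self[of "v0 i * v0 (nxt i)"]
    by (simp add: v_def abs_mult mult.assoc)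
  then have "Num v \<le> Num v0"
    unfolding Num_eq v0 Den_v using sum_mono[of "{..<n}", OF le] by simp
  with min[OF Den_v] have Num_v: "Num v = \<gamma>"
    by (simp add: \<gamma>_def)
  obtain j0 where j0: "j0 < n" "v j0 \<noteq> 0"
    using Den_v unfolding Den_def by (metis (no_types, lifting) add.right_neutral lessThan_iff mult_zero_right nxt_less power2_eq_square sum.neutral zero_neq_one)
  have \<gamma>_pos: "0 < \<gamma>"
    using Num_pos[of j0 v] j0 Num_v by simp
  have rayleigh: "\<gamma> * Den u \<le> Num u" for u
  proof (cases "\<forall>i<n. u i = 0")
    case True
    then show ?thesis by (simp add: Den_def Num_def)
  next
    case False
    then obtain i where "i < n" "u i \<noteq> 0" by blast
    then have D: "Den u > 0"
      using Den_ge[of i u] by (smt (verit) zero_less_power2)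
    then have "Den (\<lambda>i. 1 / sqrt (Den u) * u i) = 1"
      unfolding Den_scale by (simp add: power_divide)
    then have "\<gamma> \<le> Num (\<lambda>i. 1 / sqrt (Den u) * u i)"
      using min \<gamma>_def by blast
    also have "\<dots> = Num u / Den u"
      unfolding Num_scale using D by (simp add: power_divide)
    finally show ?thesis using D by (simp add: field_simps)
  qed
  have eq: "s j * v (nxt j) + s (prv j) * v (prv j) = (1 - \<gamma>) * (d j * v j)" if j: "j < n" for j
  proof -
    define F where "F u = Num u - \<gamma> * Den u" for u
    define e :: "nat \<Rightarrow> real" where "e i = (if i = j then 1 else 0)" for i
    define b where "b = (1 - \<gamma>) * (d j * v j) - (s j * v (nxt j) + s (prv j) * v (prv j))"
    have F: "F u = (\<Sum>i<n. (1 - \<gamma>) * (c i * (u i)\<^sup>2)) + (\<Sum>i<n. (1 - \<gamma>) * (c i * (u (nxt i))\<^sup>2))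
        - (\<Sum>i<n. 2 * (s i * u i * u (nxt i)))" for u
      by (simp add: F_def Num_eq Den_def sum_distrib_left sum.distrib sum_subtractf algebra_simps)
    have nxt_eq: "nxt i = j \<longleftrightarrow> i = prv j" if "i < n" for i
      using that j by auto
    have expand: "F (\<lambda>i. v i + t * e i) = F v + 2 * t * b + t\<^sup>2 * F e" for t
    proof -
      have "F (\<lambda>i. v i + t * e i) = F v + t\<^sup>2 * F e + 2 * t *
        ((\<Sum>i<n. (1 - \<gamma>) * (c i * (v i * e i))) + (\<Sum>i<n. (1 - \<gamma>) * (c i * (v (nxt i) * e (nxt i))))
          - (\<Sum>i<n. s i * (v (nxt i)) * e i) - (\<Sum>i<n. s i * v i * e (nxt i)))"
        unfolding F sum_distrib_left right_diff_distrib distrib_left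
          sum_subtractf[symmetric] sum.distrib[symmetric]
        by (intro sum.cong refl) (simp add: power2_eq_square algebra_simps)
      also have "(\<Sum>i<n. (1 - \<gamma>) * (c i * (v i * e i))) = (1 - \<gamma>) * (c j * v j)"
        using j by (simp add: e_def if_distrib cong: if_cong)
      also have "(\<Sum>i<n. (1 - \<gamma>) * (c i * (v (nxt i) * e (nxt i)))) = (\<Sum>i<n. if i = prv j then (1 - \<gamma>) * (c (prv j) * v j) else 0)"
        using j by (intro sum.cong) (auto simp: e_def nxt_eq)
      also have "(\<Sum>i<n. s i * (v (nxt i)) * e i) = s j * v (nxt j)"
        using j by (simp add: e_def if_distrib cong: if_cong)
      also have "(\<Sum>i<n. s i * v i * e (nxt i)) = (\<Sum>i<n. if i = prv j then s (prv j) * v (prv j) else 0)"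
        using j by (intro sum.cong) (auto simp: e_def nxt_eq)
      finally show ?thesis
        by (simp add: b_def d_def algebra_simps)
    qed
    have "F v = 0" "F u \<ge> 0" for u
      using Num_v Den_v rayleigh[of u] by (auto simp: F_def)
    then have quad: "0 \<le> 2 * t * b + t\<^sup>2 * F e" for t
      using expand[of t] by (metis add_0)
    \<comment> \<open>\<open>F\<close> is minimal at \<open>v\<close>, so its first variation \<open>2 b\<close> in direction \<open>e\<close> vanishes.\<close>
    have "b = 0"
    proof (rule ccontr)
      assume "b \<noteq> 0"
      \<comment> \<open>The added 1 keeps \<open>k\<close> positive even if \<open>F e = 0\<close>;
        at \<open>t = - b / k\<close> the linear term then outweighs the quadratic one.\<close>
      define k where "k = F e + 1"
      have Fe: "F e = k - 1" by (simp add: k_def)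
      have "k > 0" using \<open>\<And>u. F u \<ge> 0\<close>[of e] by (simp add: k_def)
      have "0 \<le> 2 * (- b / k) * b + (- b / k)\<^sup>2 * F e"
        by (rule quad)
      also have "\<dots> = - (b\<^sup>2 / k\<^sup>2) * (F e + 2)"
        unfolding Fe using \<open>k > 0\<close> by (simp add: field_simps power2_eq_square)
      also have "\<dots> < 0"
        using \<open>k > 0\<close> \<open>b \<noteq> 0\<close> by (simp add: k_def)
      finally show False by simp
    qed
    then show ?thesis by (simp add: b_def)
  qed
  \<comment> \<open>At a zero of \<open>v\<close> the equation equates a sum of two nonnegative
    terms with 0. Hence zeros spread from vertex to vertex round the cycle and would reach
    \<open>j0\<close>, where \<open>v\<close> is nonzero.\<close>
  have zero_step: "v (nxt j) = 0" if "j < n" "v j = 0" for j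
  proof -
    have "s j * v (nxt j) + s (prv j) * v (prv j) = 0"
      using eq[OF that(1)] that(2) by simp
    then have "s j * v (nxt j) = 0"
      using s_pos[OF that(1)] s_pos[of "prv j"] v_nonneg by (smt (verit) mult_nonneg_nonneg prv_less)
    then show ?thesis
      using s_pos[OF that(1)] by simp
  qed
  have v_pos: "0 < v i" if "i < n" for i
  proof (rule ccontr)
    assume "\<not> 0 < v i"
    then have "v i = 0" using v_nonneg[of i] by simp
    have "v ((i + k) mod n) = 0" for k
    proof (induction k)
      case 0
      then show ?case using \<open>v i = 0\<close> that by simp
    next
      case (Suc k)
      have "nxt ((i + k) mod n) = (i + Suc k) mod n"
        by (simp add: nxt_def mod_Suc_eq)
      then show ?case
        using zero_step[OF _ Suc.IH] n3 by auto
    qed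
    from this[of "n - i + j0"] have "v j0 = 0"
      using j0 that by simp
    with j0 show False by simp
  qed
  show ?thesis
    by (rule that[OF \<gamma>_pos v_pos _ rayleigh eq]) (auto simp: Num_v Den_v)
qed

end

section \<open>Spectrum of the heat-bath dynamics\<close>

text \<open>Both sides are \<open>(1 - tanh (a + b)) / 2\<close>. With
  \<open>x = exp (2 * a)\<close> and \<open>y = exp (2 * b)\<close> the identity rests on the
  factorisation \<open>x + 1 / x + y + 1 / y = (1 + x * y) * (1 / x + 1 / y)\<close>.\<close>

lemma heat_bath_prob:
  fixes a b :: real
  shows "1 / (1 + exp (2 * (a + b))) =
    (1 - (sinh (2 * a) + sinh (2 * b)) / (cosh (2 * a) + cosh (2 * b))) / 2"
proof -
  define x y where "x = exp (2 * a)" and "y = exp (2 * b)"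
  have pos: "x > 0" "y > 0" by (auto simp: x_def y_def)
  have hyp: "sinh (2 * a) = (x - 1 / x) / 2" "sinh (2 * b) = (y - 1 / y) / 2"
    "cosh (2 * a) = (x + 1 / x) / 2" "cosh (2 * b) = (y + 1 / y) / 2"
    by (simp_all add: sinh_field_def cosh_field_def x_def y_def exp_minus inverse_eq_divide)
  have "exp (2 * (a + b)) = x * y"
    by (simp add: x_def y_def distrib_left exp_add)
  moreover have "1 / (1 + x * y) = (1 - ((x - 1 / x) / 2 + (y - 1 / y) / 2) / ((x + 1 / x) / 2 + (y + 1 / y) / 2)) / 2"
  proof -
    have "(1 - ((x - 1 / x) / 2 + (y - 1 / y) / 2) / ((x + 1 / x) / 2 + (y + 1 / y) / 2)) / 2
      = (1 / x + 1 / y) / ((x + 1 / x) + (y + 1 / y))"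
    proof -
      have "(x + 1 / x) + (y + 1 / y) > 0" using pos by (simp add: add_pos_pos)
      then show ?thesis by (simp add: divide_simps) (simp add: algebra_simps)
    qed
    also have "(x + 1 / x) + (y + 1 / y) = (1 + x * y) * (1 / x + 1 / y)"
      using pos by (simp add: field_simps)
    also have "(1 / x + 1 / y) / \<dots> = 1 / (1 + x * y)"
    proof -
      have "1 / x + 1 / y > 0" using pos by (simp add: add_pos_pos)
      then show ?thesis by simp
    qed
    finally show ?thesis ..
  qed
  ultimately show ?thesis by (simp only: hyp)
qed

context ising_cycle
begin

section \<open>Single flips and the heat-bath update\<close>

lemma configs_finite: "finite (spin_configs n)"
  by (auto simp: spin_configs_def intro!: finite_PiE)

lemma spin_cases: "\<sigma> \<in> spin_configs n \<Longrightarrow> i < n \<Longrightarrow> \<sigma> i = 1 \<or> \<sigma> i = - 1"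
  by (auto simp: spin_configs_def PiE_iff)

lemma config_update: "\<sigma> \<in> spin_configs n \<Longrightarrow> i < n \<Longrightarrow> x \<in> {1, -1} \<Longrightarrow> \<sigma>(i := x) \<in> spin_configs n"
  by (auto simp: spin_configs_def PiE_iff extensional_def)

lemma flip_config: "\<sigma> \<in> spin_configs n \<Longrightarrow> i < n \<Longrightarrow> flip_spin i \<sigma> \<in> spin_configs n"
  unfolding flip_spin_def by (rule config_update) (auto dest: spin_cases)

lemma flip_neq: "\<sigma> \<in> spin_configs n \<Longrightarrow> i < n \<Longrightarrow> flip_spin i \<sigma> \<noteq> \<sigma>"
  using spin_cases[of \<sigma> i] by (auto simp: flip_spin_def fun_eq_iff)

lemma flip_inj: "\<sigma> \<in> spin_configs n \<Longrightarrow> i < n \<Longrightarrow> flip_spin i \<sigma> = flip_spin j \<sigma> \<longleftrightarrow> i = j"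
  using spin_cases[of \<sigma> i] by (auto simp: flip_spin_def fun_eq_iff split: if_splits)

text \<open>The conditional expectation of spin \<open>i\<close> given the other spins, that is
  \<open>tanh\<close> of its local field, in the form that is linear in the two neighbours.\<close>

definition mean_spin :: "nat \<Rightarrow> (nat \<Rightarrow> real) \<Rightarrow> real" where
  "mean_spin i \<sigma> = (s (prv i) * \<sigma> (prv i) + s i * \<sigma> (nxt i)) / d i"

lemma mean_spin_bound:
  assumes "\<sigma> \<in> spin_configs n" "i < n"
  shows "\<bar>mean_spin i \<sigma>\<bar> \<le> 1"
proof -
  have "s k \<le> c k" for k
    using c_minus_s[of k] by (smt (verit) exp_gt_zero)
  from this[of i] this[of "prv i"] show ?thesis
    using spin_cases[OF assms(1), of "prv i"] spin_cases[OF assms(1), of "nxt i"] s_pos[of i] s_pos[of "prv i"] d_pos[of i]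
      assms(2) by (auto simp: mean_spin_def d_def abs_le_iff divide_simps)
qed

lemma gibbs_weight_flip:
  assumes "i < n"
  shows "gibbs_weight n J (flip_spin i \<sigma>) =
    gibbs_weight n J \<sigma> * exp (- 2 * (\<sigma> i * (J (prv i) * \<sigma> (prv i) + J i * \<sigma> (nxt i))))"
proof -
  have "J k * flip_spin i \<sigma> k * flip_spin i \<sigma> (nxt k) = J k * \<sigma> k * \<sigma> (nxt k)
     + (if k = i then - 2 * (J i * \<sigma> i * \<sigma> (nxt i)) else 0)
     + (if k = prv i then - 2 * (J (prv i) * \<sigma> (prv i) * \<sigma> i) else 0)" if "k < n" for k
  proof -
    have "nxt k = i \<longleftrightarrow> k = prv i" using that assms by auto
    then show ?thesis using assms that by (auto simp: flip_spin_def)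
  qed
  then have "(\<Sum>k<n. J k * flip_spin i \<sigma> k * flip_spin i \<sigma> (nxt k)) = (\<Sum>k<n. J k * \<sigma> k * \<sigma> (nxt k)
     + (if k = i then - 2 * (J i * \<sigma> i * \<sigma> (nxt i)) else 0)
     + (if k = prv i then - 2 * (J (prv i) * \<sigma> (prv i) * \<sigma> i) else 0))"
    by (intro sum.cong) auto
  also have "\<dots> = (\<Sum>k<n. J k * \<sigma> k * \<sigma> (nxt k))
     + - 2 * (\<sigma> i * (J (prv i) * \<sigma> (prv i) + J i * \<sigma> (nxt i)))"
    using assms by (simp add: sum.distrib algebra_simps)
  finally show ?thesis
    unfolding gibbs_weight_def by (simp add: nxt_def exp_add[symmetric])
qed

lemma flip_prob_eq:
  assumes \<sigma>: "\<sigma> \<in> spin_configs n" and i: "i < n"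
  shows "flip_prob n J \<sigma> i = (1 - \<sigma> i * mean_spin i \<sigma>) / 2 / n"
proof -
  define a where "a = J (prv i) * (\<sigma> i * \<sigma> (prv i))"
  define b where "b = J i * (\<sigma> i * \<sigma> (nxt i))"
  have W: "gibbs_weight n J \<tau> > 0" for \<tau>
    by (simp add: gibbs_weight_def)
  have Z: "partition_function n J > 0"
    unfolding partition_function_def using W \<sigma> configs_finite by (intro sum_pos) auto
  have flip: "gibbs_weight n J (flip_spin i \<sigma>) = gibbs_weight n J \<sigma> / exp (2 * (a + b))"
  proof -
    have "- 2 * (\<sigma> i * (J (prv i) * \<sigma> (prv i) + J i * \<sigma> (nxt i))) = - (2 * (a + b))"
      by (simp add: a_def b_def algebra_simps)
    then show ?thesis
      unfolding gibbs_weight_flip[OF i] by (simp only: exp_minus divide_inverse)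
  qed
  have "flip_prob n J \<sigma> i = 1 / (1 + exp (2 * (a + b))) / n"
    unfolding flip_prob_def gibbs_def flip add_divide_distrib[symmetric]
  proof -
    have "1 + exp (2 * (a + b)) > 0" by (simp add: add_pos_pos)
    moreover from this have "gibbs_weight n J \<sigma> + gibbs_weight n J \<sigma> / exp (2 * (a + b)) =
        gibbs_weight n J \<sigma> / exp (2 * (a + b)) * (1 + exp (2 * (a + b)))"
      by (simp add: field_simps)
    ultimately show "1 / real n * (gibbs_weight n J \<sigma> / exp (2 * (a + b)) / partition_function n J /
        ((gibbs_weight n J \<sigma> + gibbs_weight n J \<sigma> / exp (2 * (a + b))) / partition_function n J)) =
        1 / (1 + exp (2 * (a + b))) / real n"
      using W[of \<sigma>] Z by simp
  qed
  also have "\<dots> = (1 - (sinh (2 * a) + sinh (2 * b)) / (cosh (2 * a) + cosh (2 * b))) / 2 / n"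
    by (simp only: heat_bath_prob)
  also have "(sinh (2 * a) + sinh (2 * b)) / (cosh (2 * a) + cosh (2 * b)) = \<sigma> i * mean_spin i \<sigma>"
    using spin_cases[OF \<sigma> i] spin_cases[OF \<sigma>, of "prv i"] spin_cases[OF \<sigma>, of "nxt i"]
    by (auto simp: a_def b_def mean_spin_def d_def c_def s_def add_divide_distrib diff_divide_distrib)
  finally show ?thesis .
qed

text \<open>Resampling spin \<open>i\<close> from its conditional law. The result does not depend on
  the current spin at \<open>i\<close>, which is the source of the contraction.\<close>

definition heat_bath :: "nat \<Rightarrow> ((nat \<Rightarrow> real) \<Rightarrow> real) \<Rightarrow> (nat \<Rightarrow> real) \<Rightarrow> real" where
  "heat_bath i g \<sigma> = (1 + mean_spin i \<sigma>) / 2 * g (\<sigma>(i := 1)) + (1 - mean_spin i \<sigma>) / 2 * g (\<sigma>(i := - 1))"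

definition glauber_op :: "((nat \<Rightarrow> real) \<Rightarrow> real) \<Rightarrow> (nat \<Rightarrow> real) \<Rightarrow> real" where
  "glauber_op g \<sigma> = (\<Sum>i<n. heat_bath i g \<sigma>) / n"

text \<open>The holding probability is shared out so that each site has total mass
  \<open>1 / n\<close>. At a given site, keeping and flipping the spin are then exactly the two
  outcomes of resampling it.\<close>

lemma sum_glauber:
  assumes \<sigma>: "\<sigma> \<in> spin_configs n"
  shows "(\<Sum>\<tau>\<in>spin_configs n. glauber n J \<sigma> \<tau> * g \<tau>) = glauber_op g \<sigma>"
proof -
  let ?F = "(\<lambda>i. flip_spin i \<sigma>) ` {..<n}"
  have F: "?F \<subseteq> spin_configs n - {\<sigma>}"
    using flip_config[OF \<sigma>] flip_neq[OF \<sigma>] by auto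
  have inj: "inj_on (\<lambda>i. flip_spin i \<sigma>) {..<n}"
    using flip_inj[OF \<sigma>] by (auto intro!: inj_onI)
  have flip: "glauber n J \<sigma> (flip_spin i \<sigma>) = flip_prob n J \<sigma> i" if "i < n" for i
  proof -
    have "(THE k. k < n \<and> flip_spin i \<sigma> = flip_spin k \<sigma>) = i"
      using that by (intro the_equality) (auto simp: flip_inj[OF \<sigma> that])
    then show ?thesis
      using flip_neq[OF \<sigma> that] that by (auto simp: glauber_def)
  qed
  have "(\<Sum>\<tau>\<in>spin_configs n. glauber n J \<sigma> \<tau> * g \<tau>) =
      glauber n J \<sigma> \<sigma> * g \<sigma> + (\<Sum>\<tau>\<in>spin_configs n - {\<sigma>}. glauber n J \<sigma> \<tau> * g \<tau>)"
    by (rule sum.remove[OF configs_finite \<sigma>])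
  also have "(\<Sum>\<tau>\<in>spin_configs n - {\<sigma>}. glauber n J \<sigma> \<tau> * g \<tau>) = (\<Sum>\<tau>\<in>?F. glauber n J \<sigma> \<tau> * g \<tau>)"
    by (rule sum.mono_neutral_right) (use F configs_finite in \<open>auto simp: glauber_def\<close>)
  also have "\<dots> = (\<Sum>i<n. flip_prob n J \<sigma> i * g (flip_spin i \<sigma>))"
    by (subst sum.reindex[OF inj]) (simp add: flip)
  also have "glauber n J \<sigma> \<sigma> * g \<sigma> + \<dots> = g \<sigma> + (\<Sum>i<n. flip_prob n J \<sigma> i * (g (flip_spin i \<sigma>) - g \<sigma>))"
    by (simp add: glauber_def right_diff_distrib sum_subtractf sum_distrib_right left_diff_distrib)
  also have "\<dots> = (\<Sum>i<n. g \<sigma> / n + flip_prob n J \<sigma> i * (g (flip_spin i \<sigma>) - g \<sigma>))"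
    using n3 by (simp add: sum.distrib)
  also have "\<dots> = (\<Sum>i<n. heat_bath i g \<sigma> / n)"
  proof (rule sum.cong)
    fix i assume "i \<in> {..<n}"
    then have i: "i < n" by simp
    show "g \<sigma> / n + flip_prob n J \<sigma> i * (g (flip_spin i \<sigma>) - g \<sigma>) = heat_bath i g \<sigma> / n"
    proof (cases "\<sigma> i = 1")
      case True
      then have "\<sigma>(i := 1) = \<sigma>" "flip_spin i \<sigma> = \<sigma>(i := - 1)"
        by (auto simp: flip_spin_def)
      then show ?thesis
        using n3 True by (simp add: flip_prob_eq[OF \<sigma> i] heat_bath_def field_simps)
    next
      case False
      then have "\<sigma> i = - 1" using spin_cases[OF \<sigma> i] by simp
      moreover from this have "\<sigma>(i := - 1) = \<sigma>" "flip_spin i \<sigma> = \<sigma>(i := 1)"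
        by (auto simp: flip_spin_def)
      ultimately show ?thesis
        using n3 by (simp add: flip_prob_eq[OF \<sigma> i] heat_bath_def field_simps)
    qed
  qed simp
  finally show ?thesis
    by (simp add: glauber_op_def sum_divide_distrib)
qed

text \<open>Any two configurations are joined by a path of single flips, changing the coordinates in
  which they differ one after another.\<close>

lemma flip_invariant_imp_constant:
  assumes inv: "\<And>\<sigma> j. \<sigma> \<in> spin_configs n \<Longrightarrow> j < n \<Longrightarrow> g (flip_spin j \<sigma>) = g \<sigma>"
    and \<sigma>: "\<sigma> \<in> spin_configs n" and \<tau>: "\<tau> \<in> spin_configs n"
  shows "g \<tau> = g \<sigma>"
proof -
  define mix where "mix k = (\<lambda>i. if i < k then \<tau> i else \<sigma> i)" for k :: nat
  have mix: "mix k \<in> spin_configs n" for k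
    using \<sigma> \<tau> by (auto simp: mix_def spin_configs_def PiE_iff extensional_def)
  have "g (mix k) = g \<sigma>" if "k \<le> n" for k
    using that
  proof (induction k)
    case 0
    then show ?case by (simp add: mix_def)
  next
    case (Suc k)
    then have k: "k < n" by simp
    have "mix (Suc k) = mix k \<or> mix (Suc k) = flip_spin k (mix k)"
    proof (cases "\<sigma> k = \<tau> k")
      case True
      then show ?thesis by (auto simp: mix_def fun_eq_iff less_Suc_eq)
    next
      case False
      then have "\<tau> k = - \<sigma> k" using spin_cases[OF \<sigma> k] spin_cases[OF \<tau> k] by auto
      then show ?thesis by (auto simp: mix_def fun_eq_iff less_Suc_eq flip_spin_def)
    qed
    then have "g (mix (Suc k)) = g (mix k)"
      using inv[OF mix k] by auto
    then show ?case using Suc by simp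
  qed
  moreover have "mix n = \<tau>"
    using \<sigma> \<tau> by (auto simp: mix_def spin_configs_def PiE_iff extensional_def fun_eq_iff)
  ultimately show ?thesis by auto
qed

section \<open>Contraction and the linear eigenfunction, both weighted by the Perron vector\<close>

context
  fixes \<gamma> :: real and v :: "nat \<Rightarrow> real"
  assumes v_pos: "\<And>i. i < n \<Longrightarrow> 0 < v i"
    and perron_eq: "\<And>j. j < n \<Longrightarrow> s j * v (nxt j) + s (prv j) * v (prv j) = (1 - \<gamma>) * (d j * v j)"
begin

text \<open>Resampling \<open>j\<close> erases the discrepancy, and resampling any other site
  preserves it at cost at most \<open>L * (d j * v j)\<close>. At a neighbour \<open>i\<close> the
  conditional mean shifts as well, which creates a new discrepancy at \<open>i\<close>; the factor
  \<open>d i\<close> in its weight cancels the denominator of \<open>mean_spin\<close>, leaving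
  \<open>L\<close> times the edge's \<open>s\<close> times \<open>v i\<close>. By the Perron
  equation the two neighbours together add \<open>1 - \<gamma>\<close> times the weight of
  \<open>j\<close>, so the total factor is \<open>n - 1 + (1 - \<gamma>)\<close> out of
  \<open>n\<close>.\<close>

lemma glauber_op_contraction:
  assumes lip: "\<And>\<sigma> j. \<sigma> \<in> spin_configs n \<Longrightarrow> j < n \<Longrightarrow> \<bar>g (flip_spin j \<sigma>) - g \<sigma>\<bar> \<le> L * (d j * v j)"
    and \<sigma>: "\<sigma> \<in> spin_configs n" and j: "j < n"
  shows "\<bar>glauber_op g (flip_spin j \<sigma>) - glauber_op g \<sigma>\<bar> \<le> (1 - \<gamma> / n) * L * (d j * v j)"
proof -
  define \<tau> where "\<tau> = flip_spin j \<sigma>"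
  have \<tau>: "\<tau> \<in> spin_configs n"
    using flip_config[OF \<sigma> j] by (simp add: \<tau>_def)
  have \<tau>_eq: "\<tau> k = (if k = j then - \<sigma> j else \<sigma> k)" for k
    by (simp add: \<tau>_def flip_spin_def)
  have step: "\<bar>heat_bath i g \<tau> - heat_bath i g \<sigma>\<bar> \<le> L * (d j * v j) + (if i = j then - (L * (d j * v j)) else 0)
     + (if i = nxt j then L * (s j * v (nxt j)) else 0) + (if i = prv j then L * (s (prv j) * v (prv j)) else 0)"
    (is "_ \<le> ?R") if i: "i < n" for i
  proof (cases "i = j")
    case True
    have "mean_spin j \<tau> = mean_spin j \<sigma>"
      using j by (simp add: mean_spin_def \<tau>_eq)
    moreover have "\<tau>(j := x) = \<sigma>(j := x)" for x
      by (auto simp: \<tau>_eq)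
    ultimately have "heat_bath j g \<tau> = heat_bath j g \<sigma>"
      unfolding heat_bath_def by simp
    then show ?thesis using True j by simp
  next
    case False
    have upd: "\<tau>(i := x) = flip_spin j (\<sigma>(i := x))" for x
      using False by (auto simp: \<tau>_def flip_spin_def fun_eq_iff)
    define p where "p = (1 + mean_spin i \<tau>) / 2"
    have p: "0 \<le> p" "p \<le> 1"
      using mean_spin_bound[OF \<tau> i] by (auto simp: p_def)
    define \<delta> where "\<delta> = (mean_spin i \<tau> - mean_spin i \<sigma>) / 2"
    have g1: "\<bar>g (\<tau>(i := 1)) - g (\<sigma>(i := 1))\<bar> \<le> L * (d j * v j)"
      and g2: "\<bar>g (\<tau>(i := - 1)) - g (\<sigma>(i := - 1))\<bar> \<le> L * (d j * v j)"
      unfolding upd using lip[OF config_update[OF \<sigma> i] j] by auto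
    have "flip_spin i (\<sigma>(i := - 1)) = \<sigma>(i := 1)"
      by (auto simp: flip_spin_def)
    then have g3: "\<bar>g (\<sigma>(i := 1)) - g (\<sigma>(i := - 1))\<bar> \<le> L * (d i * v i)"
      using lip[OF config_update[OF \<sigma> i] i, of "- 1"] by auto
    \<comment> \<open>Coupling of the two resampled spins: \<open>x\<close> and \<open>y\<close>
      compare configurations that received the same spin, while \<open>z\<close> is charged only for
      the change \<open>\<delta>\<close> in the probability of a plus.\<close>
    define x y z where "x = g (\<tau>(i := 1)) - g (\<sigma>(i := 1))" and "y = g (\<tau>(i := - 1)) - g (\<sigma>(i := - 1))"
      and "z = g (\<sigma>(i := 1)) - g (\<sigma>(i := - 1))"
    have "heat_bath i g \<tau> - heat_bath i g \<sigma> = p * x + (1 - p) * y + \<delta> * z"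
      by (simp add: heat_bath_def p_def \<delta>_def x_def y_def z_def field_simps)
    moreover have "\<bar>p * x\<bar> \<le> p * (L * (d j * v j))"
      using p g1 unfolding x_def[symmetric] abs_mult by (intro mult_mono) auto
    moreover have "\<bar>(1 - p) * y\<bar> \<le> (1 - p) * (L * (d j * v j))"
      using p g2 unfolding y_def[symmetric] abs_mult by (intro mult_mono) auto
    moreover have "\<bar>\<delta> * z\<bar> \<le> \<bar>\<delta>\<bar> * (L * (d i * v i))"
      using g3 unfolding z_def[symmetric] abs_mult by (intro mult_left_mono) auto
    ultimately have "\<bar>heat_bath i g \<tau> - heat_bath i g \<sigma>\<bar> \<le>
        p * (L * (d j * v j)) + (1 - p) * (L * (d j * v j)) + \<bar>\<delta>\<bar> * (L * (d i * v i))"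
      by linarith
    also have "\<dots> = L * (d j * v j) + L * (\<bar>\<delta>\<bar> * d i * v i)"
      by (simp add: algebra_simps)
    also have "\<bar>\<delta>\<bar> * d i = (if i = nxt j then s j else 0) + (if i = prv j then s (prv j) else 0)"
    proof -
      have scaled: "mean_spin i \<eta> * d i = s (prv i) * \<eta> (prv i) + s i * \<eta> (nxt i)" for \<eta>
        using d_pos[of i] by (simp add: mean_spin_def)
      have "\<delta> * d i = (mean_spin i \<tau> * d i - mean_spin i \<sigma> * d i) / 2"
        by (simp add: \<delta>_def left_diff_distrib)
      also have "\<dots> = s (prv i) * ((\<tau> (prv i) - \<sigma> (prv i)) / 2) + s i * ((\<tau> (nxt i) - \<sigma> (nxt i)) / 2)"
        unfolding scaled by (simp add: right_diff_distrib diff_divide_distrib add_divide_distrib)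
      finally have \<delta>_eq: "\<delta> * d i = \<dots>" .
      have "nxt i = j \<longleftrightarrow> i = prv j" "prv i = j \<longleftrightarrow> i = nxt j"
        using i j by auto
      then have "\<delta> * d i = (if i = nxt j then - (s j * \<sigma> j) else 0) + (if i = prv j then - (s (prv j) * \<sigma> j) else 0)"
        unfolding \<delta>_eq \<tau>_eq using i j by (cases "i = nxt j"; cases "i = prv j") auto
      moreover have "\<bar>\<delta>\<bar> * d i = \<bar>\<delta> * d i\<bar>"
        using d_pos[of i] by (simp add: abs_mult)
      moreover have "\<bar>- (s k * \<sigma> j)\<bar> = s k" if "k < n" for k
        using spin_cases[OF \<sigma> j] s_pos[OF that] by auto
      ultimately show ?thesis
        using j by (cases "i = nxt j"; cases "i = prv j") auto
    qed
    also have "L * (d j * v j) + L * (((if i = nxt j then s j else 0) + (if i = prv j then s (prv j) else 0)) * v i) = ?R"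
      using False j by auto
    finally show ?thesis .
  qed
  have "\<bar>glauber_op g \<tau> - glauber_op g \<sigma>\<bar> = \<bar>\<Sum>i<n. heat_bath i g \<tau> - heat_bath i g \<sigma>\<bar> / n"
    by (simp add: glauber_op_def sum_subtractf flip: diff_divide_distrib)
  also have "\<dots> \<le> (\<Sum>i<n. \<bar>heat_bath i g \<tau> - heat_bath i g \<sigma>\<bar>) / n"
    by (intro divide_right_mono sum_abs) simp
  also have "\<dots> \<le> (\<Sum>i<n. L * (d j * v j) + (if i = j then - (L * (d j * v j)) else 0)
     + (if i = nxt j then L * (s j * v (nxt j)) else 0) + (if i = prv j then L * (s (prv j) * v (prv j)) else 0)) / n"
    by (intro divide_right_mono sum_mono step) auto
  also have "\<dots> = (n * (L * (d j * v j)) - L * (d j * v j) + L * (s j * v (nxt j) + s (prv j) * v (prv j))) / n"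
    using j by (simp add: sum.distrib algebra_simps)
  also have "\<dots> = (1 - \<gamma> / n) * L * (d j * v j)"
    unfolding perron_eq[OF j] using n3 by (simp add: field_simps)
  finally show ?thesis by (simp add: \<tau>_def)
qed

text \<open>Let \<open>L\<close> be the best weighted Lipschitz constant, attained because there are
  finitely many flips. In differences the constant \<open>a\<close> cancels and the operator
  multiplies by \<open>\<mu>\<close> exactly, so contraction at the extremal flip forces
  \<open>L = 0\<close>.\<close>

lemma affine_eigenfunction_constant:
  assumes eig: "\<And>\<sigma>. \<sigma> \<in> spin_configs n \<Longrightarrow> glauber_op g \<sigma> = \<mu> * g \<sigma> + a"
    and \<mu>: "\<bar>\<mu>\<bar> > 1 - \<gamma> / n"
    and \<sigma>: "\<sigma> \<in> spin_configs n" and \<tau>: "\<tau> \<in> spin_configs n"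
  shows "g \<tau> = g \<sigma>"
proof -
  let ?S = "(\<lambda>(\<sigma>, j). \<bar>g (flip_spin j \<sigma>) - g \<sigma>\<bar> / (d j * v j)) ` (spin_configs n \<times> {..<n})"
  define L where "L = Max ?S"
  have fin: "finite ?S" and ne: "?S \<noteq> {}"
    using configs_finite \<sigma> n3 by (auto simp: lessThan_empty_iff)
  have w: "d j * v j > 0" if "j < n" for j
    using d_pos v_pos[OF that] by simp
  have lip: "\<bar>g (flip_spin j \<sigma>) - g \<sigma>\<bar> \<le> L * (d j * v j)" if "\<sigma> \<in> spin_configs n" "j < n" for \<sigma> j
  proof -
    have "\<bar>g (flip_spin j \<sigma>) - g \<sigma>\<bar> / (d j * v j) \<le> L"
      unfolding L_def using that by (intro Max_ge fin) auto
    then show ?thesis using w[OF that(2)] by (simp add: pos_divide_le_eq)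
  qed
  obtain \<sigma>0 j where \<sigma>0: "\<sigma>0 \<in> spin_configs n" and j: "j < n"
    and "L = \<bar>g (flip_spin j \<sigma>0) - g \<sigma>0\<bar> / (d j * v j)"
    using Max_in[OF fin ne] unfolding L_def by auto
  then have L: "\<bar>g (flip_spin j \<sigma>0) - g \<sigma>0\<bar> = L * (d j * v j)" and "L \<ge> 0"
    using w[OF j] by auto
  have "\<bar>\<mu>\<bar> * (L * (d j * v j)) = \<bar>\<mu> * (g (flip_spin j \<sigma>0) - g \<sigma>0)\<bar>"
    by (simp add: L abs_mult)
  also have "\<dots> = \<bar>glauber_op g (flip_spin j \<sigma>0) - glauber_op g \<sigma>0\<bar>"
    by (simp add: eig \<sigma>0 flip_config[OF \<sigma>0 j] right_diff_distrib)
  also have "\<dots> \<le> (1 - \<gamma> / n) * L * (d j * v j)"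
    by (rule glauber_op_contraction[OF lip \<sigma>0 j])
  finally have "(\<bar>\<mu>\<bar> - (1 - \<gamma> / n)) * (L * (d j * v j)) \<le> 0"
    by (simp add: algebra_simps)
  then have "L * (d j * v j) \<le> 0"
    using \<mu> by (simp add: mult_le_0_iff)
  then have "L \<le> 0"
    using w[OF j] by (smt (verit) mult_pos_pos)
  have "g (flip_spin j \<sigma>) = g \<sigma>" if "\<sigma> \<in> spin_configs n" "j < n" for \<sigma> j
    using lip[OF that] \<open>L \<le> 0\<close> \<open>L \<ge> 0\<close> by auto
  then show ?thesis
    using flip_invariant_imp_constant[of g, OF _ \<sigma> \<tau>] by blast
qed

text \<open>Resampling replaces \<open>\<sigma> i\<close> by its mean, whose denominator
  \<open>d i\<close> cancels; shifting the summation index moves the neighbours from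
  \<open>\<sigma>\<close> onto \<open>v\<close>, where the Perron equation applies. A flip at
  \<open>j\<close> changes this function by exactly twice the weight of \<open>j\<close>, so it
  attains the contraction rate.\<close>

lemma linear_eigenfunction:
  assumes \<sigma>: "\<sigma> \<in> spin_configs n"
  defines "f \<equiv> \<lambda>\<sigma>. \<Sum>i<n. d i * v i * \<sigma> i"
  shows "glauber_op f \<sigma> = (1 - \<gamma> / n) * f \<sigma>"
proof -
  have upd: "f (\<sigma>(i := x)) = f \<sigma> + d i * v i * (x - \<sigma> i)" if "i < n" for i x
  proof -
    have "f (\<sigma>(i := x)) = (\<Sum>k<n. d k * v k * \<sigma> k + (if k = i then d i * v i * (x - \<sigma> i) else 0))"
      unfolding f_def by (intro sum.cong) (auto simp: algebra_simps)
    then show ?thesis using that by (simp add: f_def sum.distrib)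
  qed
  have "heat_bath i f \<sigma> = f \<sigma> - d i * v i * \<sigma> i + v i * (s (prv i) * \<sigma> (prv i) + s i * \<sigma> (nxt i))"
    if "i < n" for i
  proof -
    have "heat_bath i f \<sigma> = f \<sigma> - d i * v i * \<sigma> i + v i * (d i * mean_spin i \<sigma>)"
      by (simp add: heat_bath_def upd[OF that] field_simps)
    then show ?thesis using d_pos[of i] by (simp add: mean_spin_def)
  qed
  then have "(\<Sum>i<n. heat_bath i f \<sigma>) =
    (\<Sum>i<n. f \<sigma> - d i * v i * \<sigma> i + v i * (s (prv i) * \<sigma> (prv i) + s i * \<sigma> (nxt i)))"
    by (intro sum.cong) auto
  also have "\<dots> = n * f \<sigma> - f \<sigma> + (\<Sum>i<n. v i * s (prv i) * \<sigma> (prv i)) + (\<Sum>i<n. v i * s i * \<sigma> (nxt i))"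
    by (simp add: f_def sum.distrib sum_subtractf algebra_simps)
  also have "(\<Sum>i<n. v i * s (prv i) * \<sigma> (prv i)) = (\<Sum>i<n. v (nxt i) * s i * \<sigma> i)"
    by (subst sum_nxt[symmetric]) (auto intro!: sum.cong)
  also have "(\<Sum>i<n. v i * s i * \<sigma> (nxt i)) = (\<Sum>i<n. v (prv i) * s (prv i) * \<sigma> i)"
    by (subst sum_prv[symmetric]) (auto intro!: sum.cong)
  also have "n * f \<sigma> - f \<sigma> + (\<Sum>i<n. v (nxt i) * s i * \<sigma> i) + \<dots> =
    n * f \<sigma> - f \<sigma> + (\<Sum>i<n. (s i * v (nxt i) + s (prv i) * v (prv i)) * \<sigma> i)"
    by (simp add: sum.distrib algebra_simps)
  also have "(\<Sum>i<n. (s i * v (nxt i) + s (prv i) * v (prv i)) * \<sigma> i) = (1 - \<gamma>) * f \<sigma>"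
    unfolding f_def sum_distrib_left by (intro sum.cong) (auto simp: perron_eq)
  finally show ?thesis
    using n3 by (simp add: glauber_op_def field_simps)
qed

end

section \<open>From functions on configurations to the matrix and its eigenvalue list\<close>

lemma vec_of_fun:
  assumes "x \<in> carrier_vec (2 ^ n)"
  obtains g where "x = vec (2 ^ n) (\<lambda>k. g (config_of_index n k))"
proof
  show "x = vec (2 ^ n) (\<lambda>k. x $ inv_into {..<2 ^ n} (config_of_index n) (config_of_index n k))"
    using assms bij_betw_config_of_index[of n]
    by (intro eq_vecI) (auto simp: bij_betw_def)
qed

lemma glauber_mat_mult_vec:
  "glauber_mat n J *\<^sub>v vec (2 ^ n) (\<lambda>k. g (config_of_index n k)) =
    vec (2 ^ n) (\<lambda>k. glauber_op g (config_of_index n k))"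
proof (rule eq_vecI)
  fix k assume "k < dim_vec (vec (2 ^ n) (\<lambda>k. glauber_op g (config_of_index n k)))"
  then have k: "k < 2 ^ n" by simp
  have "(glauber_mat n J *\<^sub>v vec (2 ^ n) (\<lambda>k. g (config_of_index n k))) $ k =
      (\<Sum>l<2 ^ n. glauber n J (config_of_index n k) (config_of_index n l) * g (config_of_index n l))"
    using k by (auto simp: glauber_mat_def scalar_prod_def lessThan_atLeast0 intro!: sum.cong)
  also have "\<dots> = (\<Sum>\<tau>\<in>spin_configs n. glauber n J (config_of_index n k) \<tau> * g \<tau>)"
    by (rule sum.reindex_bij_betw[OF bij_betw_config_of_index])
  also have "\<dots> = glauber_op g (config_of_index n k)"
    using k bij_betw_config_of_index[of n] by (intro sum_glauber) (auto simp: bij_betw_def)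
  finally show "(glauber_mat n J *\<^sub>v vec (2 ^ n) (\<lambda>k. g (config_of_index n k))) $ k =
      vec (2 ^ n) (\<lambda>k. glauber_op g (config_of_index n k)) $ k"
    using k by simp
qed (simp add: glauber_mat_def)

lemma vec_config_eq_iff:
  "vec (2 ^ n) (\<lambda>k. g (config_of_index n k)) = vec (2 ^ n) (\<lambda>k. h (config_of_index n k)) \<longleftrightarrow>
    (\<forall>\<sigma>\<in>spin_configs n. g \<sigma> = h \<sigma>)" (is "vec ?N ?g = vec ?N ?h \<longleftrightarrow> _")
proof -
  have "vec ?N ?g = vec ?N ?h \<longleftrightarrow> (\<forall>k\<in>{..<?N}. ?g k = ?h k)"
    by (auto simp: vec_eq_iff)
  also have "\<dots> \<longleftrightarrow> (\<forall>\<sigma>\<in>config_of_index n ` {..<?N}. g \<sigma> = h \<sigma>)"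
    by simp
  also have "config_of_index n ` {..<?N} = spin_configs n"
    using bij_betw_config_of_index[of n] by (simp add: bij_betw_def)
  finally show ?thesis .
qed

text \<open>The affine version with factor 1 shows that 1 is a simple root, and the linear
  eigenfunction supplies the root \<open>1 - \<gamma> / n\<close>. A root
  \<open>x \<noteq> 1\<close> above it would have a constant eigenfunction; constants are fixed by
  resampling, so that eigenfunction would vanish.\<close>

lemma eigenvalues_desc_glauber_mat:
  assumes \<gamma>: "0 < \<gamma>" and v_pos: "\<And>i. i < n \<Longrightarrow> 0 < v i"
    and perron_eq: "\<And>j. j < n \<Longrightarrow> s j * v (nxt j) + s (prv j) * v (prv j) = (1 - \<gamma>) * (d j * v j)"
  shows "eigenvalues_desc (glauber_mat n J) ! 1 = 1 - \<gamma> / n"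
proof -
  let ?A = "glauber_mat n J"
  let ?V = "\<lambda>g. vec (2 ^ n) (\<lambda>k. g (config_of_index n k)) :: real vec"
  obtain m where m: "(2 :: nat) ^ n = Suc m"
    by (metis gr0_conv_Suc zero_less_numeral zero_less_power)
  have A: "?A \<in> carrier_mat (2 ^ n) (2 ^ n)"
    by (simp add: glauber_mat_def)
  have n: "real n > 0" using n3 by simp
  note affine = affine_eigenfunction_constant[OF v_pos perron_eq]
  have ones: "?A *\<^sub>v ?V (\<lambda>_. 1) = ?V (\<lambda>_. 1)"
    unfolding glauber_mat_mult_vec[of "\<lambda>_. 1"] vec_config_eq_iff[of _ "\<lambda>_. 1"]
    using n by (simp add: glauber_op_def heat_bath_def add_divide_distrib[symmetric])
  have "order 1 (char_poly ?A) = 1"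
  proof (rule order_one_char_poly[of ?A m])
    fix x and a :: real
    assume "x \<in> carrier_vec (Suc m)" and x: "?A *\<^sub>v x = x + vec (Suc m) (\<lambda>_. a)"
    then obtain g where g: "x = ?V g"
      using vec_of_fun[of x] unfolding m by blast
    have "?V g + vec (Suc m) (\<lambda>_. a) = ?V (\<lambda>\<sigma>. g \<sigma> + a)"
      unfolding m by auto
    then have eig: "glauber_op g \<sigma> = 1 * g \<sigma> + a" if "\<sigma> \<in> spin_configs n" for \<sigma>
      using x that vec_config_eq_iff[of "glauber_op g" "\<lambda>\<sigma>. g \<sigma> + a"]
      unfolding g glauber_mat_mult_vec by simp
    have "\<bar>1\<bar> > 1 - \<gamma> / n"
      using \<gamma> n by simp
    from affine[OF _ _ eig this] have "g \<tau> = g \<sigma>" if "\<sigma> \<in> spin_configs n" "\<tau> \<in> spin_configs n" for \<sigma> \<tau>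
      using that by blast
    moreover have "config_of_index n 0 \<in> spin_configs n"
      using bij_betwE[OF bij_betw_config_of_index[of n]] by simp
    ultimately have "\<forall>\<sigma>\<in>spin_configs n. g \<sigma> = g (config_of_index n 0)"
      by blast
    then have "x = ?V (\<lambda>_. g (config_of_index n 0))"
      using vec_config_eq_iff[of g "\<lambda>_. g (config_of_index n 0)"] unfolding g by blast
    then show "\<exists>b. x = vec (Suc m) (\<lambda>_. b)"
      unfolding m by blast
  qed (use A ones in \<open>auto simp: m\<close>)
  moreover have "poly (char_poly ?A) (1 - \<gamma> / n) = 0"
  proof -
    let ?f = "\<lambda>\<sigma>. \<Sum>i<n. d i * v i * \<sigma> i"
    have "?A *\<^sub>v ?V ?f = ?V (\<lambda>\<sigma>. (1 - \<gamma> / n) * ?f \<sigma>)"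
      unfolding glauber_mat_mult_vec[of ?f] vec_config_eq_iff[of "glauber_op ?f" "\<lambda>\<sigma>. (1 - \<gamma> / n) * ?f \<sigma>"]
      using linear_eigenfunction[OF v_pos perron_eq] by blast
    also have "\<dots> = (1 - \<gamma> / n) \<cdot>\<^sub>v ?V ?f"
      by auto
    finally have "?A *\<^sub>v ?V ?f = (1 - \<gamma> / n) \<cdot>\<^sub>v ?V ?f" .
    moreover have "?V ?f \<noteq> 0\<^sub>v (2 ^ n)"
    proof -
      have "restrict (\<lambda>_. 1) {..<n} \<in> spin_configs n"
        by (auto simp: spin_configs_def)
      moreover have "?f (restrict (\<lambda>_. 1) {..<n}) > 0"
        using n3 d_pos v_pos by (auto intro!: sum_pos simp: lessThan_empty_iff)
      ultimately have "?V ?f \<noteq> ?V (\<lambda>_. 0)"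
        unfolding vec_config_eq_iff[of ?f "\<lambda>_. 0"] by force
      then show ?thesis by (simp add: zero_vec_def)
    qed
    ultimately have "eigenvalue ?A (1 - \<gamma> / n)"
      using A unfolding eigenvalue_def eigenvector_def by (intro exI[of _ "?V ?f"]) auto
    then show ?thesis
      using eigenvalue_root_char_poly[OF A] by simp
  qed
  moreover have "x \<le> 1 - \<gamma> / n" if root: "poly (char_poly ?A) x = 0" and "x \<noteq> 1" for x
  proof (rule ccontr)
    assume "\<not> x \<le> 1 - \<gamma> / n"
    then have large: "\<bar>x\<bar> > 1 - \<gamma> / n" by simp
    obtain y where y: "y \<in> carrier_vec (2 ^ n)" "y \<noteq> 0\<^sub>v (2 ^ n)" "?A *\<^sub>v y = x \<cdot>\<^sub>v y"
      using root A unfolding eigenvalue_root_char_poly[OF A, symmetric] eigenvalue_def eigenvector_def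
      by auto
    obtain g where g: "y = ?V g"
      using vec_of_fun[OF y(1)] .
    have "x \<cdot>\<^sub>v ?V g = ?V (\<lambda>\<sigma>. x * g \<sigma>)"
      by auto
    then have eig: "glauber_op g \<sigma> = x * g \<sigma>" if "\<sigma> \<in> spin_configs n" for \<sigma>
      using y(3) that vec_config_eq_iff[of "glauber_op g" "\<lambda>\<sigma>. x * g \<sigma>"]
      unfolding g glauber_mat_mult_vec by simp
    then have "glauber_op g \<sigma> = x * g \<sigma> + 0" if "\<sigma> \<in> spin_configs n" for \<sigma>
      using that by simp
    then have const: "g \<tau> = g \<sigma>" if "\<sigma> \<in> spin_configs n" "\<tau> \<in> spin_configs n" for \<sigma> \<tau>
      using affine[OF _ _ _ large, of g 0] that by blast
    have "g \<sigma> = 0" if \<sigma>: "\<sigma> \<in> spin_configs n" for \<sigma>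
    proof -
      have "heat_bath i g \<sigma> = g \<sigma>" if "i < n" for i
      proof -
        have "g (\<sigma>(i := 1)) = g \<sigma>" "g (\<sigma>(i := - 1)) = g \<sigma>"
          using const[OF \<sigma> config_update[OF \<sigma> that]] by auto
        then show ?thesis by (simp add: heat_bath_def field_simps)
      qed
      then have "glauber_op g \<sigma> = g \<sigma>"
        using n by (simp add: glauber_op_def)
      with eig[OF \<sigma>] \<open>x \<noteq> 1\<close> show ?thesis by auto
    qed
    then have "?V g = ?V (\<lambda>_. 0)"
      unfolding vec_config_eq_iff[of g "\<lambda>_. 0"] by blast
    with y(2) show False
      by (simp add: g zero_vec_def)
  qed
  moreover have "char_poly ?A \<noteq> 0"
    using degree_monic_char_poly[OF A] by auto
  ultimately show ?thesis
    using \<gamma> n by (intro eigenvalues_desc_nth_1[of _ 1]) auto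
qed

text \<open>The factor \<open>n\<close> in the relaxation time cancels the \<open>1 / n\<close> of
  random site selection. The inequality for all \<open>u\<close> serves for the lower bound on the
  relaxation time, the equality at a positive \<open>v\<close> for the upper bound.\<close>

lemma relaxation_time_rayleigh:
  obtains \<gamma> v where "0 < \<gamma>" "\<And>i. i < n \<Longrightarrow> 0 < v i" "Num v = \<gamma> * Den v"
    "\<And>u. \<gamma> * Den u \<le> Num u" "relaxation_time n J = 1 / \<gamma>"
proof (rule perron_vector_exists)
  fix \<gamma> v assume "0 < \<gamma>" "\<And>i. i < n \<Longrightarrow> 0 < v i" "Num v = \<gamma> * Den v" "\<And>u. \<gamma> * Den u \<le> Num u"
    "\<And>j. j < n \<Longrightarrow> s j * v (nxt j) + s (prv j) * v (prv j) = (1 - \<gamma>) * (d j * v j)"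
  then show thesis
    using n3 eigenvalues_desc_glauber_mat[of \<gamma> v]
    by (intro that[of \<gamma> v]) (auto simp: relaxation_time_def inverse_eq_divide)
qed

text \<open>
  Either all entries of \<open>v\<close> are within a factor \<open>1 - \<epsilon>\<close> of the largest entry \<open>V\<close>, or some adjacent entries
  differ by at least \<open>\<epsilon> V / n\<close>, and then one term of \<open>Num v\<close> alone is at least \<open>V\<^sup>2 Num 1\<close>.
\<close>

lemma gap_near_constant_vector:
  assumes \<epsilon>: "0 < \<epsilon>" "\<epsilon> < 1" and v_pos: "\<And>i. i < n \<Longrightarrow> 0 < v i" and eq: "Num v = \<gamma> * Den v"
    and \<gamma>: "\<gamma> > 0"
    and s_ge: "\<And>i. i < n \<Longrightarrow> S \<le> s i" and S: "(\<Sum>i<n. 2 * exp (- 2 * J i)) \<le> S * (\<epsilon> / n)\<^sup>2"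
  shows "(1 - \<epsilon>)\<^sup>2 * Num (\<lambda>_. 1) \<le> \<gamma> * Den (\<lambda>_. 1)"
proof -
  define V where "V = Max (v ` {..<n})"
  have ne: "{..<n} \<noteq> {}" using n3 by (auto simp: lessThan_empty_iff)
  have V_ge: "v i \<le> V" if "i < n" for i
    unfolding V_def using that by (intro Max_ge) auto
  have "V \<in> v ` {..<n}"
    unfolding V_def by (rule Max_in) (use ne in auto)
  then obtain k where k: "k < n" "v k = V"
    by blast
  have V: "V > 0" using v_pos k by auto
  have Num_1: "Num (\<lambda>_. 1) = (\<Sum>i<n. 2 * exp (- 2 * J i))"
    by (simp add: Num_def mult.commute)
  have Den_le: "Den v \<le> V\<^sup>2 * Den (\<lambda>_. 1)"
  proof -
    have "(v i)\<^sup>2 \<le> V\<^sup>2" if "i < n" for i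
      using V_ge[OF that] v_pos[OF that] by (intro power_mono) auto
    then have "Den v \<le> (\<Sum>i<n. c i * (V\<^sup>2 + V\<^sup>2))"
      unfolding Den_def using c_pos by (intro sum_mono mult_left_mono add_mono) (auto simp: less_imp_le)
    also have "\<dots> = V\<^sup>2 * Den (\<lambda>_. 1)"
      by (simp add: Den_def sum_distrib_left algebra_simps)
    finally show ?thesis .
  qed
  have "V\<^sup>2 * ((1 - \<epsilon>)\<^sup>2 * Num (\<lambda>_. 1)) \<le> Num v"
  proof (cases "\<forall>i<n. (1 - \<epsilon>) * V \<le> v i")
    case True
    have "((1 - \<epsilon>) * V)\<^sup>2 \<le> (v i)\<^sup>2" if "i < n" for i
      using True that \<epsilon> V by (intro power_mono) auto
    then have "0 + exp (- 2 * J i) * (((1 - \<epsilon>) * V)\<^sup>2 + ((1 - \<epsilon>) * V)\<^sup>2) \<le>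
      s i * (v i - v (nxt i))\<^sup>2 + exp (- 2 * J i) * ((v i)\<^sup>2 + (v (nxt i))\<^sup>2)" if "i < n" for i
      using that s_pos[OF that] by (intro add_mono mult_left_mono) auto
    then have "(\<Sum>i<n. 0 + exp (- 2 * J i) * (((1 - \<epsilon>) * V)\<^sup>2 + ((1 - \<epsilon>) * V)\<^sup>2)) \<le> Num v"
      unfolding Num_def by (intro sum_mono) auto
    then show ?thesis
      by (simp add: Num_1 sum_distrib_left power_mult_distrib mult_ac)
  next
    case False
    then obtain j where j: "j < n" "v j < (1 - \<epsilon>) * V" by force
    have "\<exists>i<n. \<epsilon> * V / n \<le> \<bar>v i - v (nxt i)\<bar>"
    proof (rule ccontr)
      assume "\<not> ?thesis"
      then have small: "\<bar>v i - v (nxt i)\<bar> < \<epsilon> * V / n" if "i < n" for i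
        using that by force
      have walk: "\<bar>v ((j + l) mod n) - v j\<bar> \<le> l * (\<epsilon> * V / n)" for l
      proof (induction l)
        case 0
        then show ?case using j by simp
      next
        case (Suc l)
        have "nxt ((j + l) mod n) = (j + Suc l) mod n"
          by (simp add: nxt_def mod_Suc_eq)
        then have "\<bar>v ((j + l) mod n) - v ((j + Suc l) mod n)\<bar> \<le> \<epsilon> * V / n"
          using small[of "(j + l) mod n"] n3 by simp
        moreover have "real (Suc l) * (\<epsilon> * V / n) = l * (\<epsilon> * V / n) + \<epsilon> * V / n"
          by (simp only: of_nat_Suc distrib_right mult_1_left)
        ultimately show ?case using Suc.IH by linarith
      qed
      \<comment> \<open>The number of steps from \<open>j\<close> forward to the maximiser
        \<open>k\<close>. It is less than \<open>n\<close>, so changes below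
        \<open>\<epsilon> * V / n\<close> cannot add up to \<open>V - v j\<close>, which exceeds
        \<open>\<epsilon> * V\<close>.\<close>
      define l where "l = (k + n - j) mod n"
      have "(j + l) mod n = k"
        using j k by (simp add: l_def mod_add_right_eq)
      then have "V - v j \<le> l * (\<epsilon> * V / n)"
        using walk[of l] k by simp
      also have "\<dots> \<le> n * (\<epsilon> * V / n)"
        using \<epsilon> V n3 by (intro mult_right_mono) (auto simp: l_def less_imp_le)
      also have "\<dots> = \<epsilon> * V" using n3 by simp
      finally show False using j by (simp add: algebra_simps)
    qed
    then obtain i where i: "i < n" "\<epsilon> * V / n \<le> \<bar>v i - v (nxt i)\<bar>" by blast
    have S_nonneg: "S \<ge> 0"
    proof -
      have "0 \<le> S * (\<epsilon> / n)\<^sup>2"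
        by (rule order_trans[OF sum_nonneg S]) simp
      moreover have "0 < (\<epsilon> / n)\<^sup>2"
        using \<epsilon> n3 by simp
      ultimately show ?thesis
        by (simp add: zero_le_mult_iff)
    qed
    have "V\<^sup>2 * ((1 - \<epsilon>)\<^sup>2 * Num (\<lambda>_. 1)) \<le> V\<^sup>2 * (1 * Num (\<lambda>_. 1))"
      using \<epsilon> by (intro mult_left_mono mult_right_mono) (auto simp: Num_1 power_le_one intro!: sum_nonneg)
    also have "\<dots> \<le> V\<^sup>2 * (S * (\<epsilon> / n)\<^sup>2)"
      using S by (intro mult_left_mono) (auto simp: Num_1)
    also have "\<dots> = S * (\<epsilon> * V / n)\<^sup>2"
      by (simp add: power_mult_distrib power_divide)
    also have "\<dots> \<le> s i * \<bar>v i - v (nxt i)\<bar>\<^sup>2"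
      using i \<epsilon> V S_nonneg s_ge[OF i(1)] by (intro mult_mono power_mono) auto
    also have "\<dots> \<le> s i * (v i - v (nxt i))\<^sup>2 + exp (- 2 * J i) * ((v i)\<^sup>2 + (v (nxt i))\<^sup>2)"
      by simp
    also have "\<dots> \<le> Num v"
      unfolding Num_def using i s_pos by (intro member_le_sum) (auto simp: less_imp_le)
    finally show ?thesis .
  qed
  also have "\<dots> \<le> V\<^sup>2 * (\<gamma> * Den (\<lambda>_. 1))"
    unfolding eq using Den_le \<gamma> by (simp add: mult.left_commute)
  finally show ?thesis using V by simp
qed

end

section \<open>Low-temperature asymptotics\<close>

text \<open>The time from which the upper bound holds may depend on \<open>\<epsilon>\<close>. So
  \<open>\<epsilon>\<close> is fixed first, small enough that
  \<open>l / (1 - \<epsilon>)\<^sup>2\<close> is below the target, and only then is the limit along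
  \<open>F\<close> used.\<close>

lemma tendsto_of_near_bounds:
  fixes f r :: "'a \<Rightarrow> real"
  assumes r: "(r \<longlongrightarrow> l) F" and lower: "\<forall>\<^sub>F x in F. r x \<le> f x"
    and upper: "\<And>\<epsilon>. 0 < \<epsilon> \<Longrightarrow> \<epsilon> < 1 \<Longrightarrow> \<forall>\<^sub>F x in F. f x \<le> r x / (1 - \<epsilon>)\<^sup>2"
  shows "(f \<longlongrightarrow> l) F"
proof (rule order_tendstoI)
  fix a assume "a < l"
  with r have "\<forall>\<^sub>F x in F. a < r x"
    by (rule order_tendstoD)
  with lower show "\<forall>\<^sub>F x in F. a < f x"
    by eventually_elim simp
next
  fix a assume "l < a"
  have "((\<lambda>\<epsilon>. l / (1 - \<epsilon>)\<^sup>2) \<longlongrightarrow> l / (1 - 0)\<^sup>2) (at_right 0)"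
    by (intro tendsto_intros) auto
  then have "\<forall>\<^sub>F \<epsilon> in at_right 0. l / (1 - \<epsilon>)\<^sup>2 < a"
    using \<open>l < a\<close> by (intro order_tendstoD) auto
  moreover have "\<forall>\<^sub>F \<epsilon> in at_right (0 :: real). \<epsilon> \<in> {0<..<1}"
    by (rule eventually_at_right_real) simp
  ultimately have "\<forall>\<^sub>F \<epsilon> in at_right 0. l / (1 - \<epsilon>)\<^sup>2 < a \<and> \<epsilon> \<in> {0<..<1}"
    by (rule eventually_conj)
  from eventually_happens'[OF trivial_limit_at_right_real this]
  obtain \<epsilon> where \<epsilon>: "l / (1 - \<epsilon>)\<^sup>2 < a" "0 < \<epsilon>" "\<epsilon> < 1"
    by auto
  have "((\<lambda>x. r x / (1 - \<epsilon>)\<^sup>2) \<longlongrightarrow> l / (1 - \<epsilon>)\<^sup>2) F"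
    using \<epsilon> by (intro tendsto_intros r) auto
  then have "\<forall>\<^sub>F x in F. r x / (1 - \<epsilon>)\<^sup>2 < a"
    using \<epsilon>(1) by (rule order_tendstoD)
  with upper[OF \<epsilon>(2,3)] show "\<forall>\<^sub>F x in F. f x < a"
    by eventually_elim simp
qed

text \<open>Summed over the edges, the limits 1 from \<open>a = 0\<close> count the edges whose
  coupling equals the maximum or the minimum.\<close>

lemma exp_decay_tendsto:
  fixes a :: real
  assumes "a \<ge> 0"
  shows "((\<lambda>\<beta>. exp (- (a * \<beta>))) \<longlongrightarrow> (if a = 0 then 1 else 0)) at_top"
proof (cases "a = 0")
  case False
  with assms have "filterlim (\<lambda>\<beta>. a * \<beta>) at_top at_top"
    by (intro filterlim_tendsto_pos_mult_at_top[OF tendsto_const]) (auto intro: filterlim_ident)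
  then have "((\<lambda>\<beta>. exp (- (a * \<beta>))) \<longlongrightarrow> 0) at_top"
    by (intro filterlim_compose[OF exp_at_bot] filterlim_compose[OF filterlim_uminus_at_bot_at_top])
  with False show ?thesis by simp
qed simp

lemma sum_indicator_eq_card:
  fixes n :: nat
  shows "(\<Sum>i<n. if f i = a then 1 else 0) = real (card {i. i < n \<and> f i = a})"
proof -
  have "{..<n} \<inter> {i. f i = a} = {i. i < n \<and> f i = a}"
    by auto
  then show ?thesis
    by (simp add: sum.If_cases)
qed

theorem proposition12:
  fixes n :: nat and J :: "nat \<Rightarrow> real"
  assumes "n \<ge> 3" and "\<And>i. i < n \<Longrightarrow> J i > 0"
  shows "((\<lambda>\<beta>. relaxation_time n (\<lambda>i. \<beta> * J i)
                 / exp (2 * (Max (J ` {..<n}) + Min (J ` {..<n})) * \<beta>))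
          \<longlongrightarrow> 1 / 2 * (real (card {i. i < n \<and> J i = Max (J ` {..<n})})
                     / real (card {i. i < n \<and> J i = Min (J ` {..<n})})))
         at_top"
proof -
  define M m where "M = Max (J ` {..<n})" and "m = Min (J ` {..<n})"
  define cM cm where "cM = real (card {i. i < n \<and> J i = M})" and "cm = real (card {i. i < n \<and> J i = m})"
  have ne: "J ` {..<n} \<noteq> {}"
    using assms(1) by (auto simp: lessThan_empty_iff)
  have J_le: "J i \<le> M" and J_ge: "m \<le> J i" if "i < n" for i
    using that by (auto simp: M_def m_def)
  have "m \<in> J ` {..<n}"
    unfolding m_def by (intro Min_in ne) simp
  then have "m > 0" and "{i. i < n \<and> J i = m} \<noteq> {}"
    using assms(2) by auto
  then have "cm > 0"
    by (simp add: cm_def card_gt_0_iff)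
  define N1 D1 where "N1 \<beta> = (\<Sum>i<n. 2 * exp (- 2 * (\<beta> * J i)))"
    and "D1 \<beta> = (\<Sum>i<n. 2 * cosh (2 * (\<beta> * J i)))" for \<beta>
  \<comment> \<open>The reciprocal Rayleigh quotient of the constant vector, rescaled; the
    exponential is split so that numerator and denominator converge separately, to \<open>cM\<close>
    and \<open>2 * cm\<close>.\<close>
  define R where "R \<beta> = D1 \<beta> * exp (- (2 * M * \<beta>)) / (N1 \<beta> * exp (2 * m * \<beta>))" for \<beta>
  have "((\<lambda>\<beta>. \<Sum>i<n. exp (- (2 * (M - J i) * \<beta>)) + exp (- (2 * (M + J i) * \<beta>)))
      \<longlongrightarrow> (\<Sum>i<n. (if 2 * (M - J i) = 0 then 1 else 0) + (if 2 * (M + J i) = 0 then 1 else 0))) at_top"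
  proof (intro tendsto_sum tendsto_add exp_decay_tendsto)
    fix i assume "i \<in> {..<n}"
    then show "0 \<le> 2 * (M - J i)" "0 \<le> 2 * (M + J i)"
      using J_le[of i] assms(2)[of i] by auto
  qed
  also have "(\<lambda>\<beta>. \<Sum>i<n. exp (- (2 * (M - J i) * \<beta>)) + exp (- (2 * (M + J i) * \<beta>))) =
      (\<lambda>\<beta>. D1 \<beta> * exp (- (2 * M * \<beta>)))"
    unfolding D1_def sum_distrib_right
    by (intro ext sum.cong refl) (simp add: cosh_field_def distrib_right exp_add[symmetric] algebra_simps)
  also have "(\<Sum>i<n. (if 2 * (M - J i) = 0 then 1 else 0) + (if 2 * (M + J i) = 0 then 1 else 0)) = cM"
    unfolding cM_def sum_indicator_eq_card[symmetric]
  proof (rule sum.cong)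
    fix i assume "i \<in> {..<n}"
    then show "(if 2 * (M - J i) = 0 then 1 else 0) + (if 2 * (M + J i) = 0 then 1 else 0) =
        (if J i = M then 1 else 0 :: real)"
      using J_le[of i] assms(2)[of i] by auto
  qed simp
  finally have D1_lim: "((\<lambda>\<beta>. D1 \<beta> * exp (- (2 * M * \<beta>))) \<longlongrightarrow> cM) at_top" .
  have "((\<lambda>\<beta>. \<Sum>i<n. 2 * exp (- (2 * (J i - m) * \<beta>)))
      \<longlongrightarrow> (\<Sum>i<n. 2 * (if 2 * (J i - m) = 0 then 1 else 0))) at_top"
    using J_ge by (intro tendsto_sum tendsto_mult tendsto_const exp_decay_tendsto) auto
  also have "(\<lambda>\<beta>. \<Sum>i<n. 2 * exp (- (2 * (J i - m) * \<beta>))) = (\<lambda>\<beta>. N1 \<beta> * exp (2 * m * \<beta>))"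
    unfolding N1_def sum_distrib_right
    by (intro ext sum.cong refl) (simp add: exp_add[symmetric] algebra_simps)
  also have "(\<Sum>i<n. 2 * (if 2 * (J i - m) = 0 then 1 else 0)) = 2 * cm"
    unfolding cm_def sum_indicator_eq_card[symmetric] sum_distrib_left by simp
  finally have N1_lim: "((\<lambda>\<beta>. N1 \<beta> * exp (2 * m * \<beta>)) \<longlongrightarrow> 2 * cm) at_top" .
  have R_lim: "(R \<longlongrightarrow> 1 / 2 * (cM / cm)) at_top"
    using tendsto_divide[OF D1_lim N1_lim] \<open>cm > 0\<close> by (simp add: R_def[abs_def] mult.commute)
  have cycle: "ising_cycle n (\<lambda>i. \<beta> * J i)" if "\<beta> > 0" for \<beta>
    using assms that by unfold_locales auto
  have N1_eq: "ising_cycle.Num n (\<lambda>i. \<beta> * J i) (\<lambda>_. 1) = N1 \<beta>"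
    and D1_eq: "ising_cycle.Den n (\<lambda>i. \<beta> * J i) (\<lambda>_. 1) = D1 \<beta>" if "\<beta> > 0" for \<beta>
    using cycle[OF that]
    by (simp_all add: ising_cycle.Num_def ising_cycle.Den_def ising_cycle.c_def N1_def D1_def mult.commute)
  have N1_pos: "N1 \<beta> > 0" and D1_pos: "D1 \<beta> > 0" for \<beta>
    using ne by (auto simp: N1_def D1_def intro!: sum_pos)
  have R_eq: "R \<beta> = (D1 \<beta> / N1 \<beta>) / exp (2 * (M + m) * \<beta>)" for \<beta>
    by (simp add: R_def exp_minus distrib_left distrib_right exp_add divide_simps)
  have "\<forall>\<^sub>F \<beta> in at_top. R \<beta> \<le> relaxation_time n (\<lambda>i. \<beta> * J i) / exp (2 * (M + m) * \<beta>)"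
    using eventually_gt_at_top[of 0]
  proof eventually_elim
    case (elim \<beta>)
    interpret ising_cycle n "\<lambda>i. \<beta> * J i"
      using elim by (rule cycle)
    obtain \<gamma> where \<gamma>: "0 < \<gamma>" "\<And>u. \<gamma> * Den u \<le> Num u" "relaxation_time n (\<lambda>i. \<beta> * J i) = 1 / \<gamma>"
      using relaxation_time_rayleigh by metis
    \<comment> \<open>The constant trial vector bounds the minimum \<open>\<gamma>\<close> from
      above and hence the relaxation time from below.\<close>
    have "\<gamma> * D1 \<beta> \<le> N1 \<beta>"
      using \<gamma>(2)[of "\<lambda>_. 1"] by (simp add: N1_eq D1_eq elim)
    then have "D1 \<beta> / N1 \<beta> \<le> 1 / \<gamma>"
      using \<gamma>(1) N1_pos[of \<beta>] by (simp add: field_simps)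
    then show ?case
      unfolding R_eq \<gamma>(3) by (rule divide_right_mono) simp
  qed
  moreover have "\<forall>\<^sub>F \<beta> in at_top. relaxation_time n (\<lambda>i. \<beta> * J i) / exp (2 * (M + m) * \<beta>) \<le> R \<beta> / (1 - \<epsilon>)\<^sup>2"
    if \<epsilon>: "0 < \<epsilon>" "\<epsilon> < 1" for \<epsilon>
  proof -
    have "filterlim (\<lambda>\<beta>. sinh (2 * m * \<beta>)) at_top at_top"
      using \<open>m > 0\<close> by (intro filterlim_compose[OF sinh_real_at_top]
          filterlim_tendsto_pos_mult_at_top[OF tendsto_const] filterlim_ident) auto
    \<comment> \<open>\<open>N1 \<beta>\<close> is at most \<open>2 * n\<close>, and every
      \<open>s i\<close> is at least \<open>sinh (2 * m * \<beta>)\<close> because \<open>m\<close>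
      is the smallest coupling. This threshold therefore yields the hypotheses of
      \<open>gap_near_constant_vector\<close> with
      \<open>S = sinh (2 * m * \<beta>)\<close>.\<close>
    then have "\<forall>\<^sub>F \<beta> in at_top. 2 * n / (\<epsilon> / n)\<^sup>2 \<le> sinh (2 * m * \<beta>)"
      by (simp add: filterlim_at_top)
    then show ?thesis
      using eventually_gt_at_top[of 0]
    proof eventually_elim
      case (elim \<beta>)
      interpret ising_cycle n "\<lambda>i. \<beta> * J i"
        using elim(2) by (rule cycle)
      obtain \<gamma> v where \<gamma>: "0 < \<gamma>" "\<And>i. i < n \<Longrightarrow> 0 < v i" "Num v = \<gamma> * Den v"
        "relaxation_time n (\<lambda>i. \<beta> * J i) = 1 / \<gamma>"
        using relaxation_time_rayleigh by metis
      have "N1 \<beta> \<le> (\<Sum>i<n. 2)"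
        unfolding N1_def using assms(2) elim(2) by (intro sum_mono) (simp add: less_imp_le)
      also have "\<dots> \<le> sinh (2 * m * \<beta>) * (\<epsilon> / n)\<^sup>2"
        using elim(1) \<epsilon> n3 by (simp add: pos_divide_le_eq)
      finally have S: "(\<Sum>i<n. 2 * exp (- 2 * (\<beta> * J i))) \<le> sinh (2 * m * \<beta>) * (\<epsilon> / n)\<^sup>2"
        by (simp add: N1_def)
      have s_ge: "sinh (2 * m * \<beta>) \<le> s i" if "i < n" for i
        using J_ge[OF that] elim(2) by (simp add: s_def mult.commute)
      have "(1 - \<epsilon>)\<^sup>2 * N1 \<beta> \<le> \<gamma> * D1 \<beta>"
        using gap_near_constant_vector[OF \<epsilon> \<gamma>(2,3,1) s_ge S] by (simp add: N1_eq D1_eq elim)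
      then have "1 / \<gamma> \<le> D1 \<beta> / N1 \<beta> / (1 - \<epsilon>)\<^sup>2"
        using \<gamma>(1) N1_pos[of \<beta>] \<epsilon> by (simp add: field_simps)
      then have "1 / \<gamma> / exp (2 * (M + m) * \<beta>) \<le> D1 \<beta> / N1 \<beta> / (1 - \<epsilon>)\<^sup>2 / exp (2 * (M + m) * \<beta>)"
        by (rule divide_right_mono) simp
      also have "\<dots> = R \<beta> / (1 - \<epsilon>)\<^sup>2"
        unfolding R_eq by (simp only: divide_divide_eq_left mult.commute mult.left_commute)
      finally show ?case
        unfolding \<gamma>(4) .
    qed
  qed
  ultimately have "((\<lambda>\<beta>. relaxation_time n (\<lambda>i. \<beta> * J i) / exp (2 * (M + m) * \<beta>)) \<longlongrightarrow> 1 / 2 * (cM / cm)) at_top"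
    by (rule tendsto_of_near_bounds[OF R_lim])
  then show ?thesis
    by (simp only: M_def m_def cM_def cm_def)
qed

end
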